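(* Let $R$ be a prime PI-ring such that its centre $Z(R)$ is Noetherian, and let $n\geq 1$. If $S$ is a subring of the full matrix ring $M_{n}(R)$ such that $\{rI\mid r\in Z(R)\}\subseteq S$, then $S\cap U(M_{n}(R))=U(S)$.
   Context: All rings are associative with identity (not necessarily commutative), and every subring contains the identity of the larger ring. $U(\cdot)$ denotes the group of units of a ring, $Z(R)$ the centre of $R$, $M_n(R)$ the ring of $n\times n$ matrices over $R$, and $I$ the $n\times n$ identity matrix. A PI-ring is a ring satisfying a polynomial identity $f=0$, where $f$ is a polynomial in noncommuting variables with integer coefficients, at least one of whose monomials of highest degree has coefficient $1$. *)

theory Defs
  imports
    "HOL-Algebra.Subrings"
    "HOL-Algebra.Ring_Divisibility"
    "HOL-Library.Poly_Mapping"
    "Jordan_Normal_Form.Matrix"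
begin

text \<open>The base ring is the type class \<open>ring_1\<close> (associative, unital, not necessarily commutative,
  \<open>1 \<noteq> 0\<close>), so that \<open>ring_mat\<close> is available for the matrix rings. Subrings, unit groups and
  the Noetherian condition are those of \<open>HOL-Algebra\<close>, whose \<open>subring\<close> contains the identity.\<close>

text \<open>That a prime ring is nonzero is part of \<open>ring_1\<close>.\<close>

definition prime_ring :: "'a::ring_1 itself \<Rightarrow> bool" where
  "prime_ring _ \<longleftrightarrow> (\<forall>a b :: 'a. (\<forall>r. a * r * b = 0) \<longrightarrow> a = 0 \<or> b = 0)"

text \<open>A word \<open>[i\<^sub>1, \<dots>, i\<^sub>k]\<close> stands for the noncommutative monomial \<open>X\<^sub>i\<^sub>1 \<cdots> X\<^sub>i\<^sub>k\<close>, whose degree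
  is its length; a finitely supported integer-valued function on words is an element of the free
  ring on countably many variables.\<close>

type_synonym nc_poly = "nat list \<Rightarrow>\<^sub>0 int"

definition nc_eval :: "nc_poly \<Rightarrow> (nat \<Rightarrow> 'a::ring_1) \<Rightarrow> 'a" where
  "nc_eval f x = (\<Sum>w\<in>Poly_Mapping.keys f. of_int (Poly_Mapping.lookup f w) * prod_list (map x w))"

definition has_leading_coeff_one :: "nc_poly \<Rightarrow> bool" where
  "has_leading_coeff_one f \<longleftrightarrow>
     (\<exists>w\<in>Poly_Mapping.keys f. Poly_Mapping.lookup f w = 1 \<and>
        (\<forall>v\<in>Poly_Mapping.keys f. length v \<le> length w))"

definition PI_ring :: "'a::ring_1 itself \<Rightarrow> bool" where
  "PI_ring _ \<longleftrightarrow>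
     (\<exists>f. has_leading_coeff_one f \<and> (\<forall>x :: nat \<Rightarrow> 'a. nc_eval f x = 0))"

definition ring_centre :: "'a::ring_1 set" where
  "ring_centre = {z. \<forall>r. z * r = r * z}"

definition centre_ring :: "'a::ring_1 itself \<Rightarrow> 'a ring" where
  "centre_ring _ =
     \<lparr>carrier = ring_centre, monoid.mult = (*), one = 1, zero = 0, add = (+)\<rparr>"

lemma cring_centre_ring: "cring (centre_ring TYPE('a::ring_1))"
proof -
  have commute: "x * y = y * x" if "x \<in> ring_centre" for x y :: 'a
    using that by (simp add: ring_centre_def)
  have closed: "- x \<in> ring_centre"
      "x + y \<in> ring_centre" "x * y \<in> ring_centre"
    if "x \<in> ring_centre" "y \<in> ring_centre" for x y :: 'a
  proof -
    have "(x * y) * r = r * (x * y)" for r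
      by (metis commute that mult.assoc)
    then show "x * y \<in> ring_centre" by (simp add: ring_centre_def)
    have "(x + y) * r = r * (x + y)" for r
      by (metis commute that distrib_left distrib_right)
    then show "x + y \<in> ring_centre" by (simp add: ring_centre_def)
    have "- x * r = r * - x" for r
      by (metis commute that(1) minus_mult_left minus_mult_right)
    then show "- x \<in> ring_centre" by (simp add: ring_centre_def)
  qed
  have units: "(0::'a) \<in> ring_centre" "(1::'a) \<in> ring_centre"
    by (simp_all add: ring_centre_def)
  show ?thesis
  proof (rule cringI)
    show "abelian_group (centre_ring TYPE('a))"
      by (rule abelian_groupI)
        (auto simp: centre_ring_def units closed add.assoc add.commute
          intro: closed(1) bexI[of _ "- x" for x])
    show "comm_monoid (centre_ring TYPE('a))"
      by (rule comm_monoidI)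
        (auto simp: centre_ring_def units closed mult.assoc intro: commute)
  qed (simp add: centre_ring_def distrib_right)
qed

text \<open>\<open>Matrix.ring_mat\<close> states this for commutative base rings only.\<close>

lemma ring_ring_mat: "ring (ring_mat TYPE('a::ring_1) n b)"
proof (rule ringI)
  show "abelian_group (ring_mat TYPE('a) n b)"
  proof (rule abelian_groupI)
    fix A assume "A \<in> carrier (ring_mat TYPE('a) n b)"
    then show "\<exists>y\<in>carrier (ring_mat TYPE('a) n b). y \<oplus>\<^bsub>ring_mat TYPE('a) n b\<^esub> A = \<zero>\<^bsub>ring_mat TYPE('a) n b\<^esub>"
      by (intro bexI[of _ "- A"]) (auto simp: ring_mat_def)
  qed (auto simp: ring_mat_def assoc_add_mat comm_add_mat)
  show "Group.monoid (ring_mat TYPE('a) n b)"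
    by (rule monoidI) (auto simp: ring_mat_def)
qed (auto simp: ring_mat_def add_mult_distrib_mat mult_add_distrib_mat)

end

theory Submission
  imports Defs "HOL-Combinatorics.Multiset_Permutations"
begin

text \<open>
  Let \<open>R\<close> be the ring and \<open>Z\<close> its centre. If \<open>V\<close> is the inverse of \<open>U \<in> S\<close> and the powers of \<open>V\<close>
  satisfy a relation \<open>V\<^sup>k = \<Sum> c\<^sub>l V\<^sup>l\<close> with \<open>l < k\<close> and \<open>c\<^sub>l \<in> Z\<close>, then multiplication by
  \<open>U\<^sup>k\<^sup>-\<^sup>1\<close> gives \<open>V \<in> Z[U] \<subseteq> S\<close>. Such a relation exists because \<open>Z\<close> is Noetherian and \<open>R\<close> is, up to
  a central factor, contained in a finitely generated \<open>Z\<close>-module: there are a nonzero \<open>\<zeta> \<in> Z\<close> and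
  finitely many \<open>g\<^sub>i \<in> R\<close> with \<open>\<zeta> R \<subseteq> \<Sum> Z g\<^sub>i\<close> (\<open>finite_over_centre\<close>). Hence the matrices \<open>\<zeta> V\<^sup>k\<close>
  have coordinate vectors in a free \<open>Z\<close>-module of finite rank, and one of these vectors is a
  combination of its predecessors.

  That \<open>R\<close> is finite over its centre in this sense is usually derived from the structure theory of
  prime PI-rings: Posner's theorem and central polynomials. The proof below is elementary. It
  works with the elementary operators \<open>x \<mapsto> \<Sum> a\<^sub>i x b\<^sub>i\<close>, and its basic tool is that such an operator on
  a prime ring vanishes if and only if its flip \<open>x \<mapsto> \<Sum> b\<^sub>i x a\<^sub>i\<close> does (\<open>elem_op_flip\<close>).

  Three steps lead from the polynomial identity to finiteness. First, a polynomial identity of \<open>R\<close>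
  can be made multilinear; by Regev's theorem on tensor products of PI-algebras the elementary
  operators then satisfy a multilinear identity too (\<open>two_sided_identity\<close>, \<open>elementary_identity\<close>).
  Second, this identity forbids long staircases \<open>T\<^sub>i(y\<^sub>i) = y\<^sub>i\<^sub>+\<^sub>1\<close>, \<open>T\<^sub>i(y\<^sub>j) = 0\<close> for \<open>j < i\<close>, and so
  finitely many elements suffice to detect whether an elementary operator is zero
  (\<open>finite_separating_set\<close>). Third, a minimal set of this kind behaves like a basis, and taking
  traces produces a nonzero elementary operator \<open>\<Phi>\<close> with \<open>\<Phi>(x y) = \<Phi>(y x)\<close> (\<open>trace_form_exists\<close>).
  The flip of \<open>\<Phi>\<close> takes central values. From such central functionals, and from a form \<open>\<Phi>\<close> with
  the fewest possible terms, the elements \<open>\<zeta>\<close> and \<open>g\<^sub>i\<close> can be written down.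
\<close>

section \<open>Elementary operators on a prime ring\<close>

definition elem_op :: "('a::ring_1 \<times> 'a) list \<Rightarrow> 'a \<Rightarrow> 'a" where
  "elem_op ps x = (\<Sum>(a, b)\<leftarrow>ps. a * x * b)"

text \<open>Over the extended centroid \<open>C\<close> of a prime ring \<open>R\<close> these operators span the image of
  \<open>RC \<otimes>\<^sub>C (RC)\<^sup>o\<^sup>p\<close> in \<open>End\<^sub>C(RC)\<close>. The arguments below use only operators with
  coefficients in \<open>R\<close>, so that \<open>C\<close> itself never has to be constructed.\<close>

definition elementary :: "('a::ring_1 \<Rightarrow> 'a) \<Rightarrow> bool" where
  "elementary T \<longleftrightarrow> (\<exists>ps. T = elem_op ps)"

lemma elem_op_Nil [simp]: "elem_op [] x = 0"
  by (simp add: elem_op_def)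

lemma elem_op_Cons [simp]: "elem_op (p # ps) x = fst p * x * snd p + elem_op ps x"
  by (simp add: elem_op_def case_prod_unfold)

lemma elem_op_append [simp]: "elem_op (ps @ qs) x = elem_op ps x + elem_op qs x"
  by (simp add: elem_op_def)

lemma elem_op_zero [simp]: "elem_op ps 0 = 0"
  by (induction ps) auto

lemma elem_op_add: "elem_op ps (x + y) = elem_op ps x + elem_op ps y"
  by (induction ps) (auto simp: algebra_simps)

lemma elem_op_diff: "elem_op ps (x - y) = elem_op ps x - elem_op ps y"
  by (induction ps) (auto simp: algebra_simps)

lemma elem_op_sum: "elem_op ps (\<Sum>i\<in>I. f i) = (\<Sum>i\<in>I. elem_op ps (f i))"
  by (induction I rule: infinite_finite_induct) (auto simp: elem_op_add)

lemma elem_op_sum_list: "elem_op ps (\<Sum>i\<leftarrow>is. f i) = (\<Sum>i\<leftarrow>is. elem_op ps (f i))"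
  by (induction "is") (auto simp: elem_op_add)

lemma elem_op_map: "elem_op (map h ps) x = (\<Sum>p\<leftarrow>ps. fst (h p) * x * snd (h p))"
  by (simp add: elem_op_def case_prod_unfold comp_def)

lemma elem_op_outer: "p * elem_op ps x * q = (\<Sum>(a, b)\<leftarrow>ps. p * a * x * b * q)"
  by (induction ps) (auto simp: algebra_simps)

lemma elementaryI: "(\<And>x. T x = elem_op ps x) \<Longrightarrow> elementary T"
  by (auto simp: elementary_def)

lemma elementary_mult: "elementary T \<Longrightarrow> elementary (\<lambda>x. p * T x * q)"
  unfolding elementary_def
proof (elim exE)
  fix ps assume "T = elem_op ps"
  moreover have "p * elem_op ps x * q = elem_op (map (\<lambda>(a, b). (p * a, b * q)) ps) x" for x
    by (induction ps) (auto simp: algebra_simps)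
  ultimately have "(\<lambda>x. p * T x * q) = elem_op (map (\<lambda>(a, b). (p * a, b * q)) ps)"
    by (simp add: fun_eq_iff)
  then show "\<exists>ps. (\<lambda>x. p * T x * q) = elem_op ps" by blast
qed

lemma elementary_id: "elementary (\<lambda>x. x)"
  by (rule elementaryI[of _ "[(1, 1)]"]) simp

lemma elementary_zero: "elementary (\<lambda>x. 0)"
  by (rule elementaryI[of _ "[]"]) simp

lemma elementary_add: "elementary T \<Longrightarrow> elementary S \<Longrightarrow> elementary (\<lambda>x. T x + S x)"
  unfolding elementary_def
  by (auto simp: fun_eq_iff simp flip: elem_op_append)

lemma elementary_diff:
  assumes "elementary T" "elementary S"
  shows "elementary (\<lambda>x. T x - S x)"
proof -
  have "elementary (\<lambda>x. T x + (- 1) * S x * 1)"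
    by (intro elementary_add elementary_mult assms)
  then show ?thesis by simp
qed

lemma elementary_sum: "(\<And>i. i \<in> I \<Longrightarrow> elementary (T i)) \<Longrightarrow> elementary (\<lambda>x. \<Sum>i\<in>I. T i x)"
  by (induction I rule: infinite_finite_induct) (auto simp: elementary_zero elementary_add)

lemma elementary_comp:
  assumes "elementary T" "elementary S"
  shows "elementary (\<lambda>x. T (S x))"
proof -
  obtain ps where T: "T = elem_op ps" using assms(1) by (auto simp: elementary_def)
  show ?thesis unfolding T
  proof (induction ps)
    case (Cons p ps)
    then show ?case
      by (simp add: elementary_add elementary_mult assms(2))
  qed (simp add: elementary_zero)
qed

lemma elementary_mult_arg: "elementary T \<Longrightarrow> elementary (\<lambda>x. T (p * x * q))"
  by (rule elementary_comp[of T "\<lambda>x. p * x * q"]) (auto intro: elementary_mult elementary_id)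

lemma elementary_linear:
  assumes "elementary T"
  shows "T 0 = 0" "T (x + y) = T x + T y" "T (x - y) = T x - T y" "T (\<Sum>i\<in>I. f i) = (\<Sum>i\<in>I. T (f i))"
  using assms by (auto simp: elementary_def elem_op_add elem_op_diff elem_op_sum)

lemma prime_ringD:
  fixes a b :: "'a::ring_1"
  assumes "prime_ring TYPE('a)" "\<And>r. a * r * b = 0" "a \<noteq> 0"
  shows "b = 0"
  using assms unfolding prime_ring_def by blast

text \<open>This is the substitute for computing in a tensor product over the extended centroid, where
  it says that \<open>\<Sum> a \<otimes> b = 0\<close> implies \<open>\<Sum> b \<otimes> a = 0\<close>. For a term \<open>(a, b)\<close> of the
  list, \<open>a y P(x) - P(y a x)\<close> is an operator with fewer terms that vanishes as well, so by induction
  its flip vanishes; this reads \<open>G(x a y) = G(x) y a\<close> for the flip \<open>G\<close> of \<open>P\<close>. Summing over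
  the terms gives \<open>G(x) w G(x) = G(x P(w) x) = 0\<close>, and primeness gives \<open>G(x) = 0\<close>.\<close>

lemma elem_op_flip:
  fixes ps :: "('a::ring_1 \<times> 'a) list"
  assumes prime: "prime_ring TYPE('a)" and zero: "\<And>x. elem_op ps x = 0"
  shows "elem_op (map prod.swap ps) x = 0"
  using zero
proof (induction "length ps" arbitrary: ps x rule: less_induct)
  case less
  define G where "G = elem_op (map prod.swap ps)"
  have G_sum: "G z = (\<Sum>(a, b)\<leftarrow>ps. b * z * a)" for z
    by (simp add: G_def elem_op_map case_prod_unfold)
  have shift: "G (x * a * y) = G x * y * a" if ab: "(a, b) \<in> set ps" for a b x y
  proof -
    \<comment> \<open>The term of \<open>(a, b)\<close> itself becomes zero, so \<open>l1 @ l2\<close> carries the same operator.\<close>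
    define h where "h = (\<lambda>(a', b'). (a * y * a' - a' * y * a, b' :: 'a))"
    obtain l1 l2 where ps: "ps = l1 @ (a, b) # l2" using ab by (meson split_list)
    have h0: "elem_op (map h (l1 @ l2)) z = elem_op (map h ps) z" for z
      by (simp add: ps h_def)
    have "elem_op (map h ps) z = a * y * elem_op ps z * 1 - elem_op ps (y * a * z)" for z
      unfolding elem_op_outer
      by (induction ps) (auto simp: h_def algebra_simps)
    then have "elem_op (map h (l1 @ l2)) z = 0" for z
      unfolding h0 using less.prems by simp
    then have "elem_op (map prod.swap (map h (l1 @ l2))) x = 0"
      by (intro less.hyps) (auto simp: ps)
    also have "elem_op (map prod.swap (map h (l1 @ l2))) x = elem_op (map prod.swap (map h ps)) x"
      by (simp add: ps h_def)
    also have "\<dots> = G (x * a * y) - G x * y * a"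
      unfolding G_def by (induction ps) (auto simp: h_def algebra_simps)
    finally show ?thesis by simp
  qed
  have "G x * w * G x = 0" for w
  proof -
    have "G x * w * G x = (\<Sum>(a, b)\<leftarrow>ps. G x * (w * b * x) * a)"
      by (subst (2) G_sum) (simp add: case_prod_unfold mult.assoc flip: sum_list_const_mult)
    also have "\<dots> = (\<Sum>p\<leftarrow>ps. G (x * fst p * (w * snd p * x)))"
      by (rule arg_cong[where f = sum_list]) (auto simp: shift case_prod_unfold)
    also have "\<dots> = G (\<Sum>p\<leftarrow>ps. x * fst p * (w * snd p * x))"
      unfolding G_def by (simp add: elem_op_sum_list)
    also have "(\<Sum>p\<leftarrow>ps. x * fst p * (w * snd p * x)) = x * elem_op ps w * x"
      unfolding elem_op_outer by (simp add: case_prod_unfold mult.assoc)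
    also have "G (x * elem_op ps w * x) = 0"
      using less.prems by (simp add: G_def)
    finally show ?thesis .
  qed
  then show ?case
    using prime_ringD[OF prime] unfolding G_def by metis
qed

text \<open>Flipping \<open>x \<mapsto> T(x z q)\<close> shows that \<open>z q\<close> annihilates the flip of \<open>T\<close> from the
  left for every \<open>q\<close>; as \<open>z \<noteq> 0\<close>, primeness makes the flip zero.\<close>

lemma elementary_vanish_ideal:
  fixes T :: "'a::ring_1 \<Rightarrow> 'a"
  assumes prime: "prime_ring TYPE('a)" and T: "elementary T" and z: "z \<noteq> 0"
    and vanish: "\<And>p q. T (p * z * q) = 0"
  shows "T x = 0"
proof -
  obtain ps where ps: "T = elem_op ps" using T by (auto simp: elementary_def)
  have "z * q * elem_op (map prod.swap ps) x = 0" for q x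
  proof -
    have "elem_op (map (\<lambda>(a, b). (a, z * q * b)) ps) p = T (p * z * q)" for p
      unfolding ps by (induction ps) (auto simp: algebra_simps)
    then have "elem_op (map prod.swap (map (\<lambda>(a, b). (a, z * q * b)) ps)) x = 0"
      by (intro elem_op_flip[OF prime]) (simp add: vanish)
    also have "elem_op (map prod.swap (map (\<lambda>(a, b). (a, z * q * b)) ps)) x
        = z * q * elem_op (map prod.swap ps) x"
      by (induction ps) (auto simp: algebra_simps)
    finally show ?thesis .
  qed
  then have "elem_op (map prod.swap ps) x = 0" for x
    using prime_ringD[OF prime _ z] by blast
  from elem_op_flip[OF prime this] show ?thesis
    by (simp add: ps comp_def)
qed

lemma centre_commute: "z \<in> ring_centre \<Longrightarrow> z * r = r * z"
  by (simp add: ring_centre_def)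

lemma centre_left_cancel:
  fixes z :: "'a::ring_1"
  assumes prime: "prime_ring TYPE('a)" and z: "z \<in> ring_centre" "z \<noteq> 0" and "z * a = 0"
  shows "a = 0"
proof (rule prime_ringD[OF prime _ z(2)])
  fix r
  have "z * r * a = r * (z * a)" using centre_commute[OF z(1), of r] by (simp add: mult.assoc)
  then show "z * r * a = 0" using assms(4) by simp
qed

lemma of_int_left_commute: "a * (of_int k * b) = of_int k * (a * b :: 'a::ring_1)"
proof -
  have "a * (of_int k * b) = (a * of_int k) * b" by (rule mult.assoc[symmetric])
  also have "a * of_int k = of_int k * a" by (rule mult_of_int_commute[symmetric])
  finally show ?thesis by (simp only: mult.assoc)
qed

section \<open>Multilinear identities\<close>

abbreviation perms :: "nat \<Rightarrow> nat list set" where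
  "perms n \<equiv> permutations_of_set {..<n}"

definition multilinear_identity :: "'a::ring_1 itself \<Rightarrow> nat \<Rightarrow> (nat list \<Rightarrow> int) \<Rightarrow> bool" where
  "multilinear_identity _ d \<alpha> \<longleftrightarrow>
     (\<forall>x :: nat \<Rightarrow> 'a. (\<Sum>w\<in>perms d. of_int (\<alpha> w) * prod_list (map x w)) = 0)"

lemma perms_iff: "w \<in> perms n \<longleftrightarrow> distinct w \<and> set w = {..<n}"
  by (auto simp: permutations_of_set_def)

lemma length_perms: "w \<in> perms n \<Longrightarrow> length w = n"
  by (metis perms_iff card_lessThan distinct_card)

lemma prod_list_sum_substitution:
  fixes t :: "'k \<Rightarrow> 'a::ring_1"
  assumes "finite T"
  shows "prod_list (map (\<lambda>i. \<Sum>k | k \<in> T \<and> h k = i. t k) w)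
    = (\<Sum>\<kappa> | set \<kappa> \<subseteq> T \<and> map h \<kappa> = w. prod_list (map t \<kappa>))"
proof (induction w)
  case Nil
  have "{\<kappa>. set \<kappa> \<subseteq> T \<and> map h \<kappa> = []} = {[]}" by auto
  then show ?case by simp
next
  case (Cons i w)
  let ?K = "{k. k \<in> T \<and> h k = i}" and ?S = "\<lambda>w. {\<kappa>. set \<kappa> \<subseteq> T \<and> map h \<kappa> = w}"
  have "bij_betw (\<lambda>(k, \<kappa>). k # \<kappa>) (?K \<times> ?S w) (?S (i # w))"
    by (rule bij_betwI[where g = "\<lambda>\<kappa>. (hd \<kappa>, tl \<kappa>)"]) (auto simp: map_eq_Cons_conv)
  then have "(\<Sum>\<kappa>\<in>?S (i # w). prod_list (map t \<kappa>))
      = (\<Sum>p\<in>?K \<times> ?S w. prod_list (map t ((\<lambda>(k, \<kappa>). k # \<kappa>) p)))"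
    by (rule sum.reindex_bij_betw[symmetric])
  also have "\<dots> = (\<Sum>(k, \<kappa>)\<in>?K \<times> ?S w. t k * prod_list (map t \<kappa>))"
    by (rule sum.cong) auto
  also have "\<dots> = (\<Sum>k\<in>?K. t k) * (\<Sum>\<kappa>\<in>?S w. prod_list (map t \<kappa>))"
    by (simp add: sum_product sum.cartesian_product)
  finally show ?case using Cons.IH by simp
qed

text \<open>Inclusion and exclusion: the product of \<open>1 - [x \<notin> K]\<close> over \<open>x \<in> A\<close>, multiplied out.\<close>

lemma alternating_sum_avoiding:
  assumes "finite A"
  shows "(\<Sum>X\<in>Pow A. (- 1) ^ card X * of_bool (X \<inter> K = {})) = (of_bool (A \<subseteq> K) :: int)"
proof -
  have fin: "finite X" if "X \<in> Pow A" for X using assms that finite_subset by blast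
  have "(of_bool (A \<subseteq> K) :: int) = (\<Prod>x\<in>A. 1 - of_bool (x \<notin> K))"
  proof (cases "A \<subseteq> K")
    case True
    then show ?thesis by (subst prod.neutral) auto
  next
    case False
    then have "(\<Prod>x\<in>A. 1 - of_bool (x \<notin> K)) = (0 :: int)"
      using assms by (intro prod_zero) auto
    then show ?thesis using False by simp
  qed
  also have "\<dots> = (\<Sum>X\<in>Pow A. (- 1) ^ card X * (\<Prod>x\<in>X. of_bool (x \<notin> K)) * (\<Prod>x\<in>A - X. 1))"
    by (rule prod_diff_conv_sum) (rule assms)
  also have "\<dots> = (\<Sum>X\<in>Pow A. (- 1) ^ card X * of_bool (X \<inter> K = {}))"
  proof (rule sum.cong[OF refl])
    fix X assume "X \<in> Pow A"
    have "(\<Prod>x\<in>X. of_bool (x \<notin> K)) = (of_bool (X \<inter> K = {}) :: int)"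
      using fin[OF \<open>X \<in> Pow A\<close>] by (induction X) (auto)
    then show "(- 1) ^ card X * (\<Prod>x\<in>X. of_bool (x \<notin> K)) * (\<Prod>x\<in>A - X. 1)
        = ((- 1) ^ card X * of_bool (X \<inter> K = {}) :: int)" by simp
  qed
  finally show ?thesis by simp
qed

text \<open>All multilinear parts are extracted at once. Let \<open>w\<^sub>0\<close> be the leading monomial, of degree
  \<open>d\<close>, and substitute for \<open>X\<^sub>i\<close> the sum of those \<open>t\<^sub>k\<close> with \<open>k < d\<close>, \<open>k \<notin> X\<close>, whose
  position \<open>k\<close> carries the letter \<open>i\<close> in \<open>w\<^sub>0\<close>. The alternating sum over all sets \<open>X\<close> keeps
  exactly the monomials that involve every \<open>t\<^sub>k\<close>. Since no monomial has degree greater than \<open>d\<close>,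
  these are multilinear, and the coefficient of \<open>t\<^sub>0 \<cdots> t\<^sub>d\<^sub>-\<^sub>1\<close> is that of \<open>w\<^sub>0\<close>.\<close>

lemma PI_ring_multilinear:
  assumes "PI_ring TYPE('a::ring_1)"
  shows "\<exists>d \<alpha>. multilinear_identity TYPE('a) d \<alpha> \<and> \<alpha> [0..<d] = 1"
proof -
  obtain f w0 where f: "\<And>x :: nat \<Rightarrow> 'a. nc_eval f x = 0"
    and w0: "w0 \<in> Poly_Mapping.keys f" "Poly_Mapping.lookup f w0 = 1"
    and maxi: "\<And>v. v \<in> Poly_Mapping.keys f \<Longrightarrow> length v \<le> length w0"
    using assms by (auto simp: PI_ring_def has_leading_coeff_one_def)
  define d where "d = length w0"
  define h where "h = (\<lambda>k. w0 ! k)"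
  let ?c = "Poly_Mapping.lookup f" and ?W = "Poly_Mapping.keys f" and ?A = "{..<d}"
  have "(\<Sum>\<kappa>\<in>perms d. of_int (?c (map h \<kappa>)) * prod_list (map t \<kappa>)) = 0" for t :: "nat \<Rightarrow> 'a"
  proof -
    let ?t = "\<lambda>\<kappa>. prod_list (map t \<kappa>)"
    let ?S = "\<lambda>w. {\<kappa>. set \<kappa> \<subseteq> ?A \<and> map h \<kappa> = w}"
    have fin: "finite (?S w)" for w
      by (rule finite_subset[OF _ finite_lists_length_eq[of ?A "length w"]]) auto
    have inner: "prod_list (map (\<lambda>i. \<Sum>k | k \<in> ?A - X \<and> h k = i. t k) w)
        = (\<Sum>\<kappa>\<in>?S w. of_int (of_bool (X \<inter> set \<kappa> = {})) * ?t \<kappa>)" for X w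
    proof -
      have "prod_list (map (\<lambda>i. \<Sum>k | k \<in> ?A - X \<and> h k = i. t k) w)
          = (\<Sum>\<kappa> | set \<kappa> \<subseteq> ?A - X \<and> map h \<kappa> = w. ?t \<kappa>)"
        by (rule prod_list_sum_substitution) simp
      also have "\<dots> = (\<Sum>\<kappa>\<in>?S w. of_int (of_bool (X \<inter> set \<kappa> = {})) * ?t \<kappa>)"
        by (rule sum.mono_neutral_cong_left) (use fin in auto)
      finally show ?thesis .
    qed
    have "0 = (\<Sum>X\<in>Pow ?A. of_int ((- 1) ^ card X)
        * nc_eval f (\<lambda>i. \<Sum>k | k \<in> ?A - X \<and> h k = i. t k))"
      by (simp add: f)
    also have "\<dots> = (\<Sum>X\<in>Pow ?A. \<Sum>w\<in>?W. \<Sum>\<kappa>\<in>?S w.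
        of_int (?c w * ((- 1) ^ card X * of_bool (X \<inter> set \<kappa> = {}))) * ?t \<kappa>)"
    proof -
      have "of_int s * (of_int c * (of_int e * y)) = of_int (c * (s * e)) * y" for s c e and y :: 'a
      proof -
        have "of_int s * (of_int c * (of_int e * y)) = of_int (s * c * e) * y"
          by (simp only: of_int_mult mult.assoc)
        also have "s * c * e = c * (s * e)" by simp
        finally show ?thesis .
      qed
      then show ?thesis
        unfolding nc_eval_def inner sum_distrib_left by (simp only:)
    qed
    also have "\<dots> = (\<Sum>w\<in>?W. \<Sum>X\<in>Pow ?A. \<Sum>\<kappa>\<in>?S w.
        of_int (?c w * ((- 1) ^ card X * of_bool (X \<inter> set \<kappa> = {}))) * ?t \<kappa>)"
      by (rule sum.swap)
    also have "\<dots> = (\<Sum>w\<in>?W. \<Sum>\<kappa>\<in>?S w. \<Sum>X\<in>Pow ?A.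
        of_int (?c w * ((- 1) ^ card X * of_bool (X \<inter> set \<kappa> = {}))) * ?t \<kappa>)"
      by (rule sum.cong[OF refl]) (rule sum.swap)
    also have "\<dots> = (\<Sum>w\<in>?W. \<Sum>\<kappa>\<in>?S w. of_int (?c w * of_bool (?A \<subseteq> set \<kappa>)) * ?t \<kappa>)"
      by (simp only: sum_distrib_right[symmetric] of_int_sum[symmetric] sum_distrib_left[symmetric]
          alternating_sum_avoiding[OF finite_lessThan])
    also have "\<dots> = (\<Sum>w\<in>?W. \<Sum>\<kappa> | \<kappa> \<in> perms d \<and> map h \<kappa> = w. of_int (?c (map h \<kappa>)) * ?t \<kappa>)"
    proof (rule sum.cong[OF refl])
      fix w assume "w \<in> ?W"
      then have "length w \<le> d" using maxi by (simp add: d_def)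
      then have "\<kappa> \<in> perms d" if "\<kappa> \<in> ?S w" "?A \<subseteq> set \<kappa>" for \<kappa>
      proof -
        have "length \<kappa> = length w" using that(1) by (metis (mono_tags) length_map mem_Collect_eq)
        moreover have "set \<kappa> \<subseteq> ?A" using that(1) by simp
        ultimately have "set \<kappa> = ?A" "length \<kappa> \<le> d"
          using that(2) \<open>length w \<le> d\<close> by (simp_all add: subset_antisym)
        then have "distinct \<kappa>"
          by (metis card_distinct card_length card_lessThan le_antisym)
        then show ?thesis using \<open>set \<kappa> = ?A\<close> by (simp add: perms_iff)
      qed
      then show "(\<Sum>\<kappa>\<in>?S w. of_int (?c w * of_bool (?A \<subseteq> set \<kappa>)) * ?t \<kappa>)
          = (\<Sum>\<kappa> | \<kappa> \<in> perms d \<and> map h \<kappa> = w. of_int (?c (map h \<kappa>)) * ?t \<kappa>)"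
        using fin by (intro sum.mono_neutral_cong_right) (auto simp: perms_iff)
    qed
    also have "\<dots> = (\<Sum>\<kappa>\<in>{\<kappa> \<in> perms d. map h \<kappa> \<in> ?W}. of_int (?c (map h \<kappa>)) * ?t \<kappa>)"
    proof -
      let ?D = "{\<kappa> \<in> perms d. map h \<kappa> \<in> ?W}"
      have "(\<Sum>w\<in>?W. \<Sum>\<kappa> | \<kappa> \<in> perms d \<and> map h \<kappa> = w. of_int (?c (map h \<kappa>)) * ?t \<kappa>)
          = (\<Sum>w\<in>?W. \<Sum>\<kappa> | \<kappa> \<in> ?D \<and> map h \<kappa> = w. of_int (?c (map h \<kappa>)) * ?t \<kappa>)"
        by (intro sum.cong refl) auto
      also have "\<dots> = (\<Sum>\<kappa>\<in>?D. of_int (?c (map h \<kappa>)) * ?t \<kappa>)"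
        by (rule sum.group) auto
      finally show ?thesis .
    qed
    also have "\<dots> = (\<Sum>\<kappa>\<in>perms d. of_int (?c (map h \<kappa>)) * ?t \<kappa>)"
      by (rule sum.mono_neutral_cong_left) (auto simp: in_keys_iff)
    finally show ?thesis by simp
  qed
  moreover have "?c (map h [0..<d]) = 1"
    unfolding h_def d_def map_nth using w0 by simp
  ultimately show ?thesis
    unfolding multilinear_identity_def
    by (intro exI[of _ d] exI[of _ "\<lambda>\<kappa>. ?c (map h \<kappa>)"]) simp
qed

section \<open>Words without long decreasing subsequences\<close>

text \<open>One less than the largest length of a decreasing subsequence of \<open>w\<close> that ends at position
  \<open>i\<close>.\<close>

function chain_rank :: "nat list \<Rightarrow> nat \<Rightarrow> nat" where
  "chain_rank w i = Max (insert 0 ((\<lambda>j. Suc (chain_rank w j)) ` {j. j < i \<and> w ! j > w ! i}))"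
  by auto
termination by (relation "measure snd") auto

declare chain_rank.simps [simp del]

lemma chain_rank_less:
  assumes "j < i" "w ! j > w ! i"
  shows "chain_rank w j < chain_rank w i"
proof -
  have "Suc (chain_rank w j) \<le> chain_rank w i"
    unfolding chain_rank.simps[of w i] using assms by (intro Max_ge) auto
  then show ?thesis by simp
qed

lemma chain_rank_pred:
  assumes "chain_rank w i > 0"
  shows "\<exists>j<i. w ! j > w ! i \<and> chain_rank w i = Suc (chain_rank w j)"
proof -
  have "chain_rank w i \<in> insert 0 ((\<lambda>j. Suc (chain_rank w j)) ` {j. j < i \<and> w ! j > w ! i})"
    by (subst chain_rank.simps, rule Max_in) auto
  then show ?thesis using assms by auto
qed

text \<open>The permutations of \<open>0, \<dots>, n - 1\<close> without a decreasing subsequence of length \<open>d + 1\<close>.\<close>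

definition good_words :: "nat \<Rightarrow> nat \<Rightarrow> nat list set" where
  "good_words d n = {w \<in> perms n. \<forall>i<n. chain_rank w i < d}"

text \<open>The blocks are the pieces between consecutive members of a decreasing subsequence, so that
  each block starts with one of its members.\<close>

lemma chain_rank_blocks:
  assumes "k \<le> chain_rank w i" "i < length w"
  shows "\<exists>u Bs. take i w = u @ concat Bs \<and> length Bs = k \<and> [] \<notin> set Bs \<and>
    sorted_wrt (>) (map hd Bs @ [w ! i])"
  using assms
proof (induction k arbitrary: i)
  case 0
  show ?case by (intro exI[of _ "take i w"] exI[of _ "[]"]) simp
next
  case (Suc k)
  obtain j where j: "j < i" "w ! j > w ! i" "chain_rank w i = Suc (chain_rank w j)"
    using chain_rank_pred[of w i] Suc.prems by auto
  obtain u Bs where IH: "take j w = u @ concat Bs" "length Bs = k" "[] \<notin> set Bs"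
    "sorted_wrt (>) (map hd Bs @ [w ! j])"
    using Suc.IH[of j] j Suc.prems by auto
  define B where "B = drop j (take i w)"
  have "take i w = take j (take i w) @ B" unfolding B_def by (rule append_take_drop_id[symmetric])
  also have "take j (take i w) = take j w" using j by simp
  finally have 1: "take i w = take j w @ B" .
  have 2: "B \<noteq> []" "hd B = w ! j"
    using j Suc.prems by (auto simp: B_def hd_drop_conv_nth)
  have "take i w = u @ concat (Bs @ [B])" using 1 IH(1) by simp
  moreover have "sorted_wrt (>) (map hd (Bs @ [B]) @ [w ! i])"
    using IH(4) j(2) 2 by (auto simp: sorted_wrt_append)
  ultimately show ?case
    using IH(2,3) 2 by (intro exI[of _ u] exI[of _ "Bs @ [B]"]) auto
qed

lemma bad_word_blocks:
  assumes "w \<in> perms n" "w \<notin> good_words d n"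
  shows "\<exists>u Bs. w = u @ concat Bs \<and> length Bs = Suc d \<and> [] \<notin> set Bs \<and> sorted_wrt (>) (map hd Bs)"
proof -
  obtain i where i: "i < n" "d \<le> chain_rank w i"
    using assms by (auto simp: good_words_def not_less)
  then have iw: "i < length w" using length_perms[OF assms(1)] by simp
  obtain u Bs where B: "take i w = u @ concat Bs" "length Bs = d" "[] \<notin> set Bs"
    "sorted_wrt (>) (map hd Bs @ [w ! i])"
    using chain_rank_blocks[OF i(2) iw] by blast
  have "w = u @ concat (Bs @ [drop i w])"
    using append_take_drop_id[of i w] B(1) by simp
  then show ?thesis
    using B iw by (intro exI[of _ u] exI[of _ "Bs @ [drop i w]"]) (auto simp: hd_drop_conv_nth)
qed

lemma finite_good_words: "finite (good_words d n)"
  unfolding good_words_def by (rule finite_subset[of _ "perms n"]) auto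

text \<open>The argument behind Dilworth's theorem: positions of equal rank carry increasing letters.
  A good word is therefore determined by the rank of each position together with the rank of the
  position of each letter. Indeed, at the first place where two words with the same data differ, the
  smaller of the two letters must occur later in the other word, at a position of the same rank,
  preceded by a larger letter of that rank.\<close>

lemma card_good_words: "card (good_words d n) \<le> d ^ (2 * n)"
proof -
  define pos where "pos = (\<lambda>(w :: nat list) v. THE i. i < n \<and> w ! i = v)"
  define code where "code = (\<lambda>w. (map (chain_rank w) [0..<n], map (\<lambda>v. chain_rank w (pos w v)) [0..<n]))"
  let ?L = "{l. set l \<subseteq> {..<d} \<and> length l = n}"
  have pos: "pos w (w ! i) = i" if "w \<in> perms n" "i < n" for w i
    unfolding pos_def
  proof (rule the_equality)
    fix j assume "j < n \<and> w ! j = w ! i"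
    then show "j = i" using that length_perms[OF that(1)] nth_eq_iff_index_eq[of w j i]
      by (simp add: perms_iff)
  qed (simp add: that(2))
  have pos_ex: "\<exists>i<n. w ! i = v" if "w \<in> perms n" "v < n" for w v
    using that length_perms[OF that(1)] by (metis in_set_conv_nth lessThan_iff perms_iff)
  have "code w \<in> ?L \<times> ?L" if w: "w \<in> good_words d n" for w
  proof -
    have "w \<in> perms n" and r: "\<And>i. i < n \<Longrightarrow> chain_rank w i < d" using w by (auto simp: good_words_def)
    then have "chain_rank w (pos w v) < d" if "v < n" for v
      using pos_ex[of w v] pos[of w] that by metis
    then show ?thesis using r by (auto simp: code_def)
  qed
  moreover have "inj_on code (good_words d n)"
  proof (rule inj_onI, rule ccontr)
    fix w w' assume w: "w \<in> good_words d n" "w' \<in> good_words d n" "code w = code w'" "w \<noteq> w'"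
    have perm: "w \<in> perms n" "w' \<in> perms n" using w by (auto simp: good_words_def)
    have ranks: "chain_rank w i = chain_rank w' i" "chain_rank w (pos w i) = chain_rank w' (pos w' i)" if "i < n" for i
      using w(3) that by (auto simp: code_def)
    have False if *: "w \<in> perms n" "w' \<in> perms n" "\<And>i. i < n \<Longrightarrow> chain_rank w i = chain_rank w' i"
      "\<And>v. v < n \<Longrightarrow> chain_rank w (pos w v) = chain_rank w' (pos w' v)"
      "i < n" "\<And>j. j < i \<Longrightarrow> w ! j = w' ! j" "w ! i < w' ! i" for w w' i
    proof -
      have "w ! i < n" using *(1,5) length_perms[OF *(1)] by (metis lessThan_iff nth_mem perms_iff)
      then obtain j where j: "j < n" "w' ! j = w ! i" using pos_ex *(2) by blast
      have "\<not> j < i"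
      proof
        assume "j < i"
        then have "w ! j = w ! i" using *(6) j by simp
        then show False using \<open>j < i\<close> *(1,5) length_perms[OF *(1)]
          by (auto simp: perms_iff nth_eq_iff_index_eq)
      qed
      moreover have "j \<noteq> i" using j *(7) by auto
      ultimately have "i < j" by simp
      then have "chain_rank w' i < chain_rank w' j" using j *(7) by (intro chain_rank_less) auto
      moreover have "chain_rank w i = chain_rank w' j"
        using *(4)[OF \<open>w ! i < n\<close>] pos[OF *(1,5)] pos[OF *(2) j(1)] j(2) by simp
      ultimately show False using *(3,5) by simp
    qed
    note contra = this
    obtain i where "i < n" "w ! i \<noteq> w' ! i"
      using w(4) length_perms[OF perm(1)] length_perms[OF perm(2)] by (metis nth_equalityI)
    then have "\<exists>i. i < n \<and> w ! i \<noteq> w' ! i" by blast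
    then obtain i where i: "i < n" "w ! i \<noteq> w' ! i" "\<And>j. j < i \<Longrightarrow> \<not> (j < n \<and> w ! j \<noteq> w' ! j)"
      using exists_least_iff[of "\<lambda>i. i < n \<and> w ! i \<noteq> w' ! i"] by blast
    then have eq: "\<And>j. j < i \<Longrightarrow> w ! j = w' ! j" by auto
    show False
      using contra[OF perm ranks i(1) eq] contra[OF perm(2,1) ranks[symmetric] i(1) eq[symmetric]] i(2)
      by (meson linorder_neqE_nat)
  qed
  ultimately have "card (good_words d n) \<le> card (?L \<times> ?L)"
  proof (intro card_inj_on_le[of code])
    show "finite (?L \<times> ?L)"
      using finite_lists_length_eq[of "{..<d}" n] by (intro finite_cartesian_product) auto
  qed blast+
  also have "\<dots> = d ^ n * d ^ n"
    by (simp add: card_cartesian_product card_lists_length_eq)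
  finally show ?thesis by (simp add: mult_2 power_add)
qed

lemma mset_permute_blocks:
  assumes "v \<in> perms (length Bs)"
  shows "mset (concat (map ((!) Bs) v)) = mset (concat Bs)"
proof -
  have "mset_set (set v) = mset v" using assms by (intro mset_set_set) (simp add: perms_iff)
  moreover have "set v = {0..<length Bs}" using assms by (simp add: perms_iff atLeast0LessThan)
  ultimately have "mset v = mset [0..<length Bs]" by simp
  then have "mset (map ((!) Bs) v) = mset (map ((!) Bs) [0..<length Bs])" by (simp only: mset_map)
  then have "mset (map ((!) Bs) v) = mset Bs" unfolding map_nth .
  moreover have "mset (concat xss) = sum_mset (image_mset mset (mset xss))" for xss :: "'a list list"
  proof -
    have "sum_mset (image_mset mset (mset xss)) = sum_mset (mset (map mset xss))" by (simp only: mset_map)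
    then show ?thesis unfolding sum_mset_sum_list mset_concat by (rule sym)
  qed
  ultimately show ?thesis by (simp only:)
qed

lemma lex_less_thanI:
  assumes "length xs = length ys" "xs = p @ x # xs'" "ys = p @ y # ys'" "x < y"
  shows "(xs, ys) \<in> lex less_than"
  using assms by (auto simp: lex_conv)

text \<open>At the first moved block a block with a smaller first letter comes in, because the first
  letters decrease.\<close>

lemma permute_blocks_lex:
  assumes Bs: "[] \<notin> set Bs" "sorted_wrt (>) (map hd Bs)" and v: "v \<in> perms (length Bs)" "v \<noteq> [0..<length Bs]"
  shows "(u @ concat (map ((!) Bs) v), u @ concat Bs) \<in> lex less_than"
proof -
  let ?d = "length Bs"
  have len: "length v = ?d" by (rule length_perms[OF v(1)])
  have "\<exists>k. k < ?d \<and> v ! k \<noteq> k"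
  proof (rule ccontr)
    assume "\<not> ?thesis"
    then have "v = [0..<?d]" using len by (intro nth_equalityI) auto
    then show False using v(2) by simp
  qed
  then have "\<exists>k. (k < ?d \<and> v ! k \<noteq> k) \<and> (\<forall>j<k. \<not> (j < ?d \<and> v ! j \<noteq> j))"
    by (rule exists_least_iff[THEN iffD1])
  then obtain k where k: "k < ?d" "v ! k \<noteq> k" and least: "\<forall>j<k. \<not> (j < ?d \<and> v ! j \<noteq> j)"
    by (elim exE conjE)
  have eq: "v ! j = j" if "j < k" for j using least k(1) that by simp
  have "v ! k \<in> set v" using k(1) len by simp
  then have "v ! k < ?d" using v(1) unfolding perms_iff by simp
  have "\<not> v ! k < k"
  proof
    assume less: "v ! k < k"
    then have "v ! (v ! k) = v ! k" by (rule eq)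
    then have "v ! k = k"
      using nth_eq_iff_index_eq[of v "v ! k" k] v(1) k(1) len less by (simp add: perms_iff)
    then show False using k(2) by simp
  qed
  then have "k < v ! k" using k(2) by simp
  define a where "a = v ! k"
  have hd_less: "hd (Bs ! a) < hd (Bs ! k)"
    using Bs(2) \<open>k < v ! k\<close> \<open>v ! k < ?d\<close> k(1) unfolding a_def sorted_wrt_iff_nth_less by simp
  have "Bs ! a \<in> set Bs" "Bs ! k \<in> set Bs"
    using k(1) \<open>v ! k < ?d\<close> by (simp_all add: a_def)
  then have ne: "Bs ! a \<noteq> []" "Bs ! k \<noteq> []" using Bs(1) by metis+
  have "take k v = [0..<k]" using eq k(1) len by (intro nth_equalityI) auto
  then have tk: "map ((!) Bs) (take k v) = take k Bs"
    using k(1) by (auto simp: list_eq_iff_nth_eq)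
  have v_split: "map ((!) Bs) v = take k Bs @ (Bs ! a) # map ((!) Bs) (drop (Suc k) v)"
  proof -
    have "v = take k v @ v ! k # drop (Suc k) v"
      by (rule id_take_nth_drop) (simp add: k(1) len)
    from arg_cong[OF this, of "map ((!) Bs)"]
    have "map ((!) Bs) v = map ((!) Bs) (take k v @ v ! k # drop (Suc k) v)" .
    also have "\<dots> = map ((!) Bs) (take k v) @ (Bs ! a) # map ((!) Bs) (drop (Suc k) v)"
      by (simp only: map_append list.map a_def)
    finally show ?thesis by (simp only: tk)
  qed
  have B_split: "Bs = take k Bs @ (Bs ! k) # drop (Suc k) Bs" using k(1) by (rule id_take_nth_drop)
  have "length (concat (map ((!) Bs) v)) = length (concat Bs)"
    by (rule mset_eq_length[OF mset_permute_blocks[OF v(1)]])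
  then have "length (u @ concat (map ((!) Bs) v)) = length (u @ concat Bs)"
    by simp
  moreover obtain x xs y ys where xy: "Bs ! a = x # xs" "Bs ! k = y # ys"
    using ne by (meson neq_Nil_conv)
  have "u @ concat (map ((!) Bs) v)
      = (u @ concat (take k Bs)) @ x # (xs @ concat (map ((!) Bs) (drop (Suc k) v)))"
    by (simp add: v_split xy)
  moreover have "u @ concat Bs = (u @ concat (take k Bs)) @ y # (ys @ concat (drop (Suc k) Bs))"
    using arg_cong[OF B_split, of "\<lambda>B. u @ concat B"] by (simp only: concat_append concat.simps append_assoc xy append_Cons)
  moreover have "x < y" using hd_less by (simp add: xy)
  ultimately show ?thesis by (rule lex_less_thanI)
qed

text \<open>Latyshev's reduction. A word that is not good ends in \<open>d + 1\<close> blocks with decreasing first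
  letters. The identity applied to these blocks rewrites the word as a combination of
  lexicographically smaller words, in which the same blocks occur in another order.\<close>

lemma good_words_span:
  assumes identity: "multilinear_identity TYPE('a::ring_1) (Suc d) \<alpha>" and lead: "\<alpha> [0..<Suc d] = 1"
    and w: "w \<in> perms n"
  shows "\<exists>c :: nat list \<Rightarrow> int. \<forall>x :: nat \<Rightarrow> 'a.
    prod_list (map x w) = (\<Sum>v\<in>good_words d n. of_int (c v) * prod_list (map x v))"
  using w
proof (induction w rule: wf_induct_rule[OF wf_lex[OF wf_less_than]])
  case (1 w)
  show ?case
  proof (cases "w \<in> good_words d n")
    case True
    have "(\<Sum>v\<in>good_words d n. of_int (of_bool (v = w)) * prod_list (map x v)) = prod_list (map x w)"
      for x :: "nat \<Rightarrow> 'a"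
    proof -
      have "(\<Sum>v\<in>good_words d n. of_int (of_bool (v = w)) * prod_list (map x v))
          = (\<Sum>v\<in>good_words d n. if v = w then prod_list (map x w) else 0)"
        by (rule sum.cong) auto
      then show ?thesis using True by (simp add: finite_good_words)
    qed
    then show ?thesis by (intro exI[of _ "\<lambda>v. of_bool (v = w)"]) simp
  next
    case False
    obtain u Bs where B: "w = u @ concat Bs" "length Bs = Suc d" "[] \<notin> set Bs" "sorted_wrt (>) (map hd Bs)"
      using bad_word_blocks[OF 1(2) False] by blast
    define g where "g = (\<lambda>v. u @ concat (map ((!) Bs) v))"
    let ?V = "perms (Suc d) - {[0..<Suc d]}"
    have "\<exists>c :: nat list \<Rightarrow> int. \<forall>x :: nat \<Rightarrow> 'a.
      prod_list (map x (g v)) = (\<Sum>v\<in>good_words d n. of_int (c v) * prod_list (map x v))" if v: "v \<in> ?V" for v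
    proof (rule 1(1))
      show "(g v, w) \<in> lex less_than"
        unfolding g_def B(1) using v B by (intro permute_blocks_lex) (auto simp del: upt_Suc)
      have "mset (g v) = mset w"
        using mset_permute_blocks[of v Bs] v by (simp add: g_def B(1,2) del: upt_Suc)
      then show "g v \<in> perms n"
        using 1(2) unfolding perms_iff by (metis mset_eq_imp_distinct_iff mset_eq_setD)
    qed
    then obtain c where c: "\<And>v x. v \<in> ?V \<Longrightarrow>
        prod_list (map (x :: nat \<Rightarrow> 'a) (g v)) = (\<Sum>t\<in>good_words d n. of_int (c v t) * prod_list (map x t))"
      by metis
    have "prod_list (map x w)
        = (\<Sum>t\<in>good_words d n. of_int (\<Sum>v\<in>?V. - \<alpha> v * c v t) * prod_list (map x t))" for x :: "nat \<Rightarrow> 'a"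
    proof -
      define y where "y = (\<lambda>j. prod_list (map x (Bs ! j)))"
      have y: "prod_list (map x u) * prod_list (map y v) = prod_list (map x (g v))" for v
      proof -
        have "prod_list (map y v) = prod_list (map x (concat (map ((!) Bs) v)))"
          by (induction v) (auto simp: y_def)
        then show ?thesis by (simp add: g_def)
      qed
      have id: "[0..<Suc d] \<in> perms (Suc d)" by (auto simp: perms_iff)
      have "0 = prod_list (map x u) * (\<Sum>v\<in>perms (Suc d). of_int (\<alpha> v) * prod_list (map y v))"
        using identity by (simp add: multilinear_identity_def)
      also have "\<dots> = (\<Sum>v\<in>perms (Suc d). of_int (\<alpha> v) * prod_list (map x (g v)))"
        unfolding y[symmetric] sum_distrib_left
        by (intro sum.cong refl of_int_left_commute)
      also have "\<dots> = prod_list (map x (g [0..<Suc d])) + (\<Sum>v\<in>?V. of_int (\<alpha> v) * prod_list (map x (g v)))"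
        by (subst sum.remove[OF _ id]) (auto simp: lead simp del: upt_Suc)
      also have "g [0..<Suc d] = w"
        unfolding g_def B(1) B(2)[symmetric] map_nth ..
      also have "(\<Sum>v\<in>?V. of_int (\<alpha> v) * prod_list (map x (g v)))
          = (\<Sum>v\<in>?V. \<Sum>t\<in>good_words d n. of_int (\<alpha> v * c v t) * prod_list (map x t))"
        by (intro sum.cong refl) (simp only: c sum_distrib_left of_int_mult mult.assoc)
      also have "\<dots> = (\<Sum>t\<in>good_words d n. of_int (\<Sum>v\<in>?V. \<alpha> v * c v t) * prod_list (map x t))"
        by (subst sum.swap) (simp only: of_int_sum sum_distrib_right)
      finally have "prod_list (map x w)
          = - (\<Sum>t\<in>good_words d n. of_int (\<Sum>v\<in>?V. \<alpha> v * c v t) * prod_list (map x t))"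
        by (simp add: eq_neg_iff_add_eq_0)
      then show ?thesis by (simp add: sum_negf)
    qed
    then show ?thesis by - (rule exI[of _ "\<lambda>t. \<Sum>v\<in>?V. - \<alpha> v * c v t"], rule allI)
  qed
qed

section \<open>Integer solutions of underdetermined systems\<close>

text \<open>Gaussian elimination of one unknown, without division.\<close>

lemma integer_kernel:
  fixes c :: "'j \<Rightarrow> 'i \<Rightarrow> int"
  assumes "finite J" "finite I" "card J < card I"
  shows "\<exists>\<beta>. (\<exists>i\<in>I. \<beta> i \<noteq> 0) \<and> (\<forall>j\<in>J. (\<Sum>i\<in>I. c j i * \<beta> i) = 0)"
  using assms
proof (induction J arbitrary: I c rule: finite_induct)
  case empty
  then obtain i where "i \<in> I" by fastforce
  then show ?case by (intro exI[of _ "\<lambda>_. 1"]) auto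
next
  case (insert j J)
  show ?case
  proof (cases "\<forall>i\<in>I. c j i = 0")
    case True
    obtain \<beta> where "\<exists>i\<in>I. \<beta> i \<noteq> 0" "\<forall>j\<in>J. (\<Sum>i\<in>I. c j i * \<beta> i) = 0"
      using insert.IH[of I c] insert.prems insert.hyps by auto
    then show ?thesis using True by (intro exI[of _ \<beta>]) auto
  next
    case False
    then obtain k where k: "k \<in> I" "c j k \<noteq> 0" by blast
    let ?I = "I - {k}"
    have "finite ?I" "card J < card ?I" using insert.prems insert.hyps k by simp_all
    from insert.IH[OF this, of "\<lambda>j' i. c j k * c j' i - c j' k * c j i"]
    obtain \<gamma> where \<gamma>: "\<exists>i\<in>?I. \<gamma> i \<noteq> 0"
      "\<forall>j'\<in>J. (\<Sum>i\<in>?I. (c j k * c j' i - c j' k * c j i) * \<gamma> i) = 0"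
      by blast
    \<comment> \<open>Solve equation \<open>j\<close> for the unknown \<open>k\<close>, after scaling by its coefficient.\<close>
    define \<beta> where "\<beta> = (\<lambda>i. if i = k then - (\<Sum>i\<in>?I. c j i * \<gamma> i) else c j k * \<gamma> i)"
    have split: "(\<Sum>i\<in>I. c j' i * \<beta> i) = (\<Sum>i\<in>?I. (c j k * c j' i - c j' k * c j i) * \<gamma> i)" for j'
    proof -
      have "(\<Sum>i\<in>I. c j' i * \<beta> i) = c j' k * \<beta> k + (\<Sum>i\<in>?I. c j' i * \<beta> i)"
        by (rule sum.remove[OF insert.prems(1) k(1)])
      also have "(\<Sum>i\<in>?I. c j' i * \<beta> i) = (\<Sum>i\<in>?I. c j' i * (c j k * \<gamma> i))"
        by (rule sum.cong) (auto simp: \<beta>_def)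
      finally show ?thesis
        by (simp add: \<beta>_def left_diff_distrib right_diff_distrib sum_subtractf sum_distrib_left mult_ac)
    qed
    have "(\<Sum>i\<in>I. c j' i * \<beta> i) = 0" if "j' \<in> insert j J" for j'
      unfolding split using that \<gamma>(2) by (cases "j' = j") auto
    moreover have "\<exists>i\<in>I. \<beta> i \<noteq> 0" using \<gamma>(1) k by (auto simp: \<beta>_def)
    ultimately show ?thesis by blast
  qed
qed

text \<open>A nonzero solution of minimal size is not divisible by the characteristic of the ring, since
  otherwise the quotient would be a smaller solution.\<close>

lemma integer_kernel_char:
  fixes c :: "'j \<Rightarrow> 'i \<Rightarrow> int"
  assumes fin: "finite J" "finite I" and card: "card J < card I"
  shows "\<exists>\<beta>. (\<exists>i\<in>I. of_int (\<beta> i) \<noteq> (0::'a::ring_1)) \<and> (\<forall>j\<in>J. (\<Sum>i\<in>I. c j i * \<beta> i) = 0)"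
proof -
  define sol where "sol = (\<lambda>\<beta>. (\<exists>i\<in>I. \<beta> i \<noteq> 0) \<and> (\<forall>j\<in>J. (\<Sum>i\<in>I. c j i * \<beta> i) = 0))"
  define size where "size = (\<lambda>\<beta> :: 'i \<Rightarrow> int. \<Sum>i\<in>I. nat \<bar>\<beta> i\<bar>)"
  have "\<exists>\<beta>. sol \<beta>" unfolding sol_def by (rule integer_kernel[OF fin card])
  then obtain \<beta> where \<beta>: "sol \<beta>" and minimal: "\<And>\<gamma>. sol \<gamma> \<Longrightarrow> size \<beta> \<le> size \<gamma>"
    using ex_has_least_nat[of sol _ size] by blast
  have "\<exists>i\<in>I. of_int (\<beta> i) \<noteq> (0::'a)"
  proof (rule ccontr)
    assume "\<not> ?thesis"
    then have "\<forall>i\<in>I. int CHAR('a) dvd \<beta> i" by (auto simp: of_int_eq_0_iff_char_dvd)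
    then have dvd: "int CHAR('a) dvd \<beta> i" if "i \<in> I" for i using that by blast
    define \<gamma> where "\<gamma> = (\<lambda>i. \<beta> i div int CHAR('a))"
    have \<gamma>: "\<beta> i = int CHAR('a) * \<gamma> i" if "i \<in> I" for i
      unfolding \<gamma>_def by (rule dvd_mult_div_cancel[OF dvd[OF that], symmetric])
    obtain k where k: "k \<in> I" "\<beta> k \<noteq> 0" using \<beta> by (auto simp: sol_def)
    have "CHAR('a) \<noteq> 1"
    proof
      assume "CHAR('a) = 1"
      then have "(1::'a) = 0" using of_nat_CHAR[where 'a = 'a] by simp
      then show False by simp
    qed
    moreover have "CHAR('a) \<noteq> 0" using \<gamma>[OF k(1)] k(2) by auto
    ultimately have p: "CHAR('a) > 1" by linarith
    have "(\<Sum>i\<in>I. c j i * \<gamma> i) = 0" if "j \<in> J" for j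
    proof -
      have "int CHAR('a) * (\<Sum>i\<in>I. c j i * \<gamma> i) = (\<Sum>i\<in>I. c j i * \<beta> i)"
        unfolding sum_distrib_left by (rule sum.cong) (auto simp: \<gamma>)
      then show ?thesis using \<beta> that p by (simp add: sol_def)
    qed
    moreover have "\<gamma> k \<noteq> 0" using k \<gamma> by auto
    ultimately have "sol \<gamma>" using k(1) by (auto simp: sol_def)
    moreover have "size \<gamma> < size \<beta>"
      unfolding size_def
    proof (rule sum_strict_mono_ex1[OF fin(2)])
      show "\<forall>i\<in>I. nat \<bar>\<gamma> i\<bar> \<le> nat \<bar>\<beta> i\<bar>" using \<gamma> p by (auto simp: abs_mult nat_mult_distrib)
      show "\<exists>i\<in>I. nat \<bar>\<gamma> i\<bar> < nat \<bar>\<beta> i\<bar>"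
        using \<gamma> p k by (intro bexI[of _ k]) (auto simp: abs_mult nat_mult_distrib)
    qed
    ultimately show False using minimal[of \<gamma>] by simp
  qed
  then show ?thesis using \<beta> by (auto simp: sol_def)
qed

lemma power_less_fact_exists: "\<exists>n. (a::nat) ^ n < fact n"
proof -
  have "(\<lambda>n. inverse (fact n) * real a ^ n) \<longlonglongrightarrow> 0"
    by (rule summable_LIMSEQ_zero[OF summable_exp])
  then have "eventually (\<lambda>n. inverse (fact n) * real a ^ n < 1) sequentially"
    by (rule order_tendstoD) simp
  then obtain n where "inverse (fact n) * real a ^ n < 1"
    by (auto simp: eventually_sequentially)
  then have "real a ^ n < fact n" by (simp add: field_simps)
  then have "real (a ^ n) < real (fact n)" by simp
  then show ?thesis using of_nat_less_iff by blast
qed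

section \<open>A polynomial identity for elementary operators\<close>

text \<open>Regev's counting argument. Both \<open>w\<close> applied to \<open>p\<close> and the reversed word applied to
  \<open>q\<close> are combinations of good words, so the sum vanishes as soon as the coefficients \<open>\<beta>\<close> solve
  one linear equation for every pair of good words. There are at most \<open>d\<^bsup>4n\<^esup>\<close> such pairs, but
  \<open>n!\<close> unknowns. The reversal of the second word is what makes this an identity for compositions of
  the operators \<open>x \<mapsto> p\<^sub>i x q\<^sub>i\<close>.\<close>

lemma two_sided_identity:
  assumes identity: "multilinear_identity TYPE('a::ring_1) (Suc d) \<alpha>" and lead: "\<alpha> [0..<Suc d] = 1"
  shows "\<exists>n \<beta> w0. w0 \<in> perms n \<and> of_int (\<beta> w0) \<noteq> (0::'a) \<and>
    (\<forall>(p :: nat \<Rightarrow> 'a) q y. (\<Sum>w\<in>perms n. of_int (\<beta> w) *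
      (prod_list (map p w) * y * prod_list (map q (rev w)))) = 0)"
proof -
  obtain n where n: "(d ^ 4) ^ n < fact n" using power_less_fact_exists by blast
  let ?G = "good_words d n"
  have "\<exists>c :: nat list \<Rightarrow> int. \<forall>x :: nat \<Rightarrow> 'a. prod_list (map x w) = (\<Sum>v\<in>?G. of_int (c v) * prod_list (map x v))"
    if "w \<in> perms n" for w
    by (rule good_words_span[OF identity lead that])
  then obtain c where c: "\<And>w x. w \<in> perms n \<Longrightarrow>
      prod_list (map (x :: nat \<Rightarrow> 'a) w) = (\<Sum>v\<in>?G. of_int (c w v) * prod_list (map x v))"
    by metis
  \<comment> \<open>More unknowns \<open>\<beta> w\<close> than equations, one equation for each pair of good words.\<close>
  have "card (?G \<times> ?G) \<le> d ^ (2 * n) * d ^ (2 * n)"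
    by (simp add: card_cartesian_product mult_mono card_good_words)
  also have "\<dots> = (d ^ 4) ^ n" by (simp flip: power_add power_mult)
  also have "\<dots> < card (perms n)" using n by simp
  finally have card: "card (?G \<times> ?G) < card (perms n)" .
  have "\<exists>\<beta>. (\<exists>w\<in>perms n. of_int (\<beta> w) \<noteq> (0::'a)) \<and>
      (\<forall>j\<in>?G \<times> ?G. (\<Sum>w\<in>perms n. (c w (fst j) * c (rev w) (snd j)) * \<beta> w) = 0)"
    by (rule integer_kernel_char[OF _ _ card]) (simp_all add: finite_good_words)
  then obtain \<beta> where \<beta>: "\<exists>w\<in>perms n. of_int (\<beta> w) \<noteq> (0::'a)"
    "\<And>v v'. v \<in> ?G \<Longrightarrow> v' \<in> ?G \<Longrightarrow> (\<Sum>w\<in>perms n. c w v * c (rev w) v' * \<beta> w) = 0"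
    by fastforce
  have zero: "(\<Sum>w\<in>perms n. of_int (\<beta> w) * (prod_list (map p w) * y * prod_list (map q (rev w)))) = 0"
    for p q :: "nat \<Rightarrow> 'a" and y
  proof -
    have "(\<Sum>w\<in>perms n. of_int (\<beta> w) * (prod_list (map p w) * y * prod_list (map q (rev w))))
        = (\<Sum>w\<in>perms n. \<Sum>v\<in>?G. \<Sum>v'\<in>?G. of_int (c w v * c (rev w) v' * \<beta> w) *
            (prod_list (map p v) * y * prod_list (map q v')))"
    proof (rule sum.cong[OF refl])
      fix w assume w: "w \<in> perms n"
      then have rw: "rev w \<in> perms n" by (simp add: perms_iff)
      have coeffs: "of_int b * ((of_int s * P) * y * (of_int t * Q)) = of_int (s * t * b) * (P * y * Q)"
        for b s t and P Q :: 'a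
      proof -
        have "(of_int s * P) * y * (of_int t * Q) = of_int t * ((of_int s * P) * y * Q)"
          by (rule of_int_left_commute)
        then have "of_int b * ((of_int s * P) * y * (of_int t * Q)) = of_int (b * t * s) * (P * y * Q)"
          by (simp only: of_int_mult mult.assoc)
        also have "b * t * s = s * t * b" by simp
        finally show ?thesis .
      qed
      have "of_int (\<beta> w) * (prod_list (map p w) * y * prod_list (map q (rev w)))
          = (\<Sum>v'\<in>?G. \<Sum>v\<in>?G. of_int (\<beta> w) * ((of_int (c w v) * prod_list (map p v)) * y *
              (of_int (c (rev w) v') * prod_list (map q v'))))"
        unfolding c[OF w] c[OF rw] sum_distrib_left sum_distrib_right ..
      also have "\<dots> = (\<Sum>v\<in>?G. \<Sum>v'\<in>?G. of_int (c w v * c (rev w) v' * \<beta> w) *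
            (prod_list (map p v) * y * prod_list (map q v')))"
        unfolding coeffs by (rule sum.swap)
      finally show "of_int (\<beta> w) * (prod_list (map p w) * y * prod_list (map q (rev w))) = \<dots>" .
    qed
    also have "\<dots> = (\<Sum>v\<in>?G. \<Sum>w\<in>perms n. \<Sum>v'\<in>?G. of_int (c w v * c (rev w) v' * \<beta> w) *
            (prod_list (map p v) * y * prod_list (map q v')))"
      by (rule sum.swap)
    also have "\<dots> = (\<Sum>v\<in>?G. \<Sum>v'\<in>?G. \<Sum>w\<in>perms n. of_int (c w v * c (rev w) v' * \<beta> w) *
            (prod_list (map p v) * y * prod_list (map q v')))"
      by (rule sum.cong[OF refl]) (rule sum.swap)
    also have "\<dots> = 0"
    proof (rule sum.neutral, rule ballI, rule sum.neutral, rule ballI)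
      fix v v' assume "v \<in> ?G" "v' \<in> ?G"
      then show "(\<Sum>w\<in>perms n. of_int (c w v * c (rev w) v' * \<beta> w) *
            (prod_list (map p v) * y * prod_list (map q v'))) = 0"
        unfolding sum_distrib_right[symmetric] of_int_sum[symmetric] \<beta>(2)[OF \<open>v \<in> ?G\<close> \<open>v' \<in> ?G\<close>] by simp
    qed
    finally show ?thesis .
  qed
  obtain w0 where "w0 \<in> perms n" "of_int (\<beta> w0) \<noteq> (0::'a)" using \<beta>(1) by (elim bexE)
  then show ?thesis by (intro exI[of _ n] exI[of _ \<beta>] exI[of _ w0] conjI allI zero)
qed

abbreviation elem_word :: "(nat \<Rightarrow> ('a::ring_1 \<times> 'a) list) \<Rightarrow> nat list \<Rightarrow> 'a \<Rightarrow> 'a" where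
  "elem_word ps w \<equiv> foldr (\<lambda>i. elem_op (ps i)) w"

lemma elem_word_zero [simp]: "elem_word ps w 0 = 0"
  by (induction w) auto

lemma elem_word_add: "elem_word ps w (x + y) = elem_word ps w x + elem_word ps w y"
  by (induction w) (auto simp: elem_op_add)

lemma elem_word_upd_notin: "j \<notin> set w \<Longrightarrow> elem_word (ps(j := l)) w x = elem_word ps w x"
  by (induction w) auto

lemma elem_word_upd:
  assumes "distinct w" "j \<in> set w"
  shows "elem_word (ps(j := [])) w x = 0"
    and "elem_word (ps(j := a # l)) w x = elem_word (ps(j := [a])) w x + elem_word (ps(j := l)) w x"
proof -
  obtain w1 w2 where w: "w = w1 @ j # w2" using assms(2) by (meson split_list)
  then have j: "j \<notin> set w1" "j \<notin> set w2" using assms(1) by auto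
  show "elem_word (ps(j := [])) w x = 0" by (simp add: w)
  show "elem_word (ps(j := a # l)) w x = elem_word (ps(j := [a])) w x + elem_word (ps(j := l)) w x"
    by (simp add: w elem_word_upd_notin j elem_word_add fun_upd_same del: fun_upd_apply)
qed

lemma elem_word_single: "elem_word (\<lambda>i. [(p i, q i)]) w x = prod_list (map p w) * x * prod_list (map q (rev w))"
  by (induction w) (auto simp: mult.assoc)

text \<open>By multilinearity in the operators it is enough to treat operators with a single term
  \<open>x \<mapsto> p x q\<close>; the induction admits arbitrary operators for one letter after the other.\<close>

lemma elementary_identity:
  fixes \<beta> :: "nat list \<Rightarrow> int" and ps :: "nat \<Rightarrow> ('a::ring_1 \<times> 'a) list"
  assumes two_sided: "\<And>(p :: nat \<Rightarrow> 'a) q y. (\<Sum>w\<in>perms n. of_int (\<beta> w) *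
      (prod_list (map p w) * y * prod_list (map q (rev w)))) = 0"
  shows "(\<Sum>w\<in>perms n. of_int (\<beta> w) * elem_word ps w y) = 0"
proof -
  have "(\<Sum>w\<in>perms n. of_int (\<beta> w) * elem_word ps w y) = 0"
    if "finite J" "J \<subseteq> {..<n}" "\<forall>i\<in>{..<n} - J. \<exists>p q. ps i = [(p, q)]" for J ps
    using that
  proof (induction J arbitrary: ps rule: finite_induct)
    case empty
    then obtain p q where pq: "\<And>i. i < n \<Longrightarrow> ps i = [(p i, q i)]"
      by (metis Diff_empty lessThan_iff)
    have "elem_word ps w y = prod_list (map p w) * y * prod_list (map q (rev w))" if "w \<in> perms n" for w
    proof -
      have "elem_word ps w y = elem_word (\<lambda>i. [(p i, q i)]) w y"
        using that pq by (intro foldr_cong) (auto simp: perms_iff)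
      then show ?thesis by (simp only: elem_word_single)
    qed
    then have "(\<Sum>w\<in>perms n. of_int (\<beta> w) * elem_word ps w y) = (\<Sum>w\<in>perms n. of_int (\<beta> w) *
      (prod_list (map p w) * y * prod_list (map q (rev w))))"
      by (intro sum.cong) auto
    then show ?case using two_sided by simp
  next
    case (insert j J)
    have j: "j \<in> set w" "distinct w" if "w \<in> perms n" for w
      using that insert.prems(1) by (auto simp: perms_iff)
    have "(\<Sum>w\<in>perms n. of_int (\<beta> w) * elem_word (ps(j := l)) w y) = 0" for l
    proof (induction l)
      case Nil
      show ?case
        by (rule sum.neutral) (simp add: elem_word_upd(1) j del: fun_upd_apply)
    next
      case (Cons a l)
      have "(\<Sum>w\<in>perms n. of_int (\<beta> w) * elem_word (ps(j := a # l)) w y)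
          = (\<Sum>w\<in>perms n. of_int (\<beta> w) * elem_word (ps(j := [a])) w y)
            + (\<Sum>w\<in>perms n. of_int (\<beta> w) * elem_word (ps(j := l)) w y)"
        unfolding sum.distrib[symmetric] distrib_left[symmetric]
        by (rule sum.cong) (simp_all only: elem_word_upd(2)[OF j(2,1), of _ _ a l])
      also have "(\<Sum>w\<in>perms n. of_int (\<beta> w) * elem_word (ps(j := [a])) w y) = 0"
        using insert.prems by (intro insert.IH) (auto intro: prod.exhaust[of a])
      finally show ?case using Cons.IH by simp
    qed
    from this[of "ps j"] show ?case by simp
  qed
  from this[of "{..<n}" ps] show ?thesis by simp
qed

section \<open>Finite separating sets\<close>

text \<open>Over the extended centroid of a prime ring this says that the set spans the central closure.\<close>

definition separating :: "'a::ring_1 set \<Rightarrow> bool" where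
  "separating X \<longleftrightarrow> (\<forall>T x. elementary T \<longrightarrow> (\<forall>a\<in>X. T a = 0) \<longrightarrow> T x = 0)"

text \<open>An operator \<open>Q\<close> that kills \<open>y\<^sub>0, \<dots>, y\<^sub>n\<^sub>-\<^sub>1\<close> but not \<open>y\<^sub>n\<close> is carried
  along, since \<open>y\<^sub>n\<close> has to be chosen after the operator that must not kill it. The next operator
  \<open>Q'\<close> cannot vanish on the ideal generated by \<open>Q(y\<^sub>n)\<close>, so \<open>y\<^sub>n\<^sub>+\<^sub>1\<close> is taken there as
  \<open>p Q(y\<^sub>n) q\<close>, and \<open>T\<^sub>n\<close> is \<open>Q\<close> followed by \<open>x \<mapsto> p x q\<close>.\<close>

lemma elementary_staircase:
  fixes n :: nat
  assumes prime: "prime_ring TYPE('a::ring_1)"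
    and unseparated: "\<And>X :: 'a set. finite X \<Longrightarrow> \<exists>T x. elementary T \<and> (\<forall>a\<in>X. T a = 0) \<and> T x \<noteq> 0"
  shows "\<exists>(y :: nat \<Rightarrow> 'a) T. (\<forall>i<n. elementary (T i) \<and> (\<forall>j<i. T i (y j) = 0) \<and> T i (y i) = y (Suc i)) \<and> y n \<noteq> 0"
proof -
  have "\<exists>(y :: nat \<Rightarrow> 'a) T Q. (\<forall>i<n. elementary (T i) \<and> (\<forall>j<i. T i (y j) = 0) \<and> T i (y i) = y (Suc i)) \<and>
      elementary Q \<and> (\<forall>j<n. Q (y j) = 0) \<and> Q (y n) \<noteq> 0"
  proof (induction n)
    case 0
    show ?case by (intro exI[of _ "\<lambda>_. 1"] exI[of _ undefined] exI[of _ "\<lambda>x. x"]) (simp add: elementary_id)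
  next
    case (Suc n)
    then obtain y T Q where T: "\<And>i. i < n \<Longrightarrow> elementary (T i)" "\<And>i j. i < n \<Longrightarrow> j < i \<Longrightarrow> T i (y j) = 0"
        "\<And>i. i < n \<Longrightarrow> T i (y i) = y (Suc i)"
      and Q: "elementary Q" "\<And>j. j < n \<Longrightarrow> Q (y j) = (0::'a)" "Q (y n) \<noteq> 0"
      by blast
    obtain Q' x where Q': "elementary Q'" "\<forall>a\<in>y ` {..n}. Q' a = 0" "Q' x \<noteq> 0"
      using unseparated[of "y ` {..n}"] by auto
    obtain p q where pq: "Q' (p * Q (y n) * q) \<noteq> 0"
      using elementary_vanish_ideal[OF prime Q'(1) Q(3)] Q'(3) by blast
    define z where "z = y(Suc n := p * Q (y n) * q)"
    define S where "S = T(n := \<lambda>x. p * Q x * q)"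
    have "elementary (S i) \<and> (\<forall>j<i. S i (z j) = 0) \<and> S i (z i) = z (Suc i)" if "i < Suc n" for i
      using that T Q by (cases "i = n") (auto simp: S_def z_def elementary_mult)
    moreover have "Q' (z j) = 0" if "j < Suc n" for j
      using that Q'(2) by (auto simp: z_def)
    moreover have "Q' (z (Suc n)) \<noteq> 0" using pq by (simp add: z_def)
    ultimately show ?case using Q'(1) by blast
  qed
  then obtain y T Q where "\<forall>i<n. elementary (T i) \<and> (\<forall>j<i. T i (y j) = 0) \<and> T i (y i) = y (Suc i)"
    "elementary Q" "Q (y n) \<noteq> (0::'a)" by blast
  then show ?thesis by (metis elementary_linear(1))
qed

text \<open>If no finite set separates, there is a staircase \<open>T\<^sub>i(y\<^sub>i) = y\<^sub>i\<^sub>+\<^sub>1\<close> with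
  \<open>T\<^sub>i(y\<^sub>j) = 0\<close> for \<open>j < i\<close>. Only one order of composing all the \<open>T\<^sub>i\<close> does not kill \<open>y\<^sub>0\<close>,
  so the multilinear identity of the elementary operators, evaluated at \<open>y\<^sub>0\<close>, leaves a single
  nonzero term.\<close>

lemma finite_separating_set:
  assumes prime: "prime_ring TYPE('a::ring_1)"
    and identity: "multilinear_identity TYPE('a::ring_1) (Suc d) \<alpha>" and lead: "\<alpha> [0..<Suc d] = 1"
  shows "\<exists>X :: 'a set. finite X \<and> separating X"
proof (rule ccontr)
  assume "\<not> ?thesis"
  then have unseparated: "\<exists>T x. elementary T \<and> (\<forall>a\<in>X. T a = 0) \<and> T x \<noteq> 0" if "finite X" for X :: "'a set"
    using that unfolding separating_def by blast
  from two_sided_identity[OF identity lead] obtain n \<beta> w0 where w0: "w0 \<in> perms n" "of_int (\<beta> w0) \<noteq> (0::'a)"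
    and "\<forall>(p :: nat \<Rightarrow> 'a) q y. (\<Sum>w\<in>perms n. of_int (\<beta> w) *
      (prod_list (map p w) * y * prod_list (map q (rev w)))) = 0"
    by (elim exE conjE)
  then have two_sided: "(\<Sum>w\<in>perms n. of_int (\<beta> w) *
      (prod_list (map p w) * y * prod_list (map q (rev w)))) = 0" for p q :: "nat \<Rightarrow> 'a" and y
    by (elim allE)
  obtain y :: "nat \<Rightarrow> 'a" and T where T: "\<And>i. i < n \<Longrightarrow> elementary (T i)"
    "\<And>i j. i < n \<Longrightarrow> j < i \<Longrightarrow> T i (y j) = 0" "\<And>i. i < n \<Longrightarrow> T i (y i) = y (Suc i)" "y n \<noteq> 0"
    using elementary_staircase[OF prime unseparated, of n] by blast
  \<comment> \<open>The rightmost operator of a word acts first, so the letter \<open>r ! i\<close> gets the operator \<open>T i\<close>.\<close>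
  define r where "r = rev w0"
  have r: "distinct r" "set r = {..<n}" "length r = n"
    using w0(1) length_perms[OF w0(1)] by (auto simp: r_def perms_iff)
  define idx where "idx = inv_into {..<n} ((!) r)"
  have idx: "idx a < n" "r ! idx a = a" if "a < n" for a
  proof -
    have "a \<in> (!) r ` {..<n}" using that r by (metis atLeast_upt image_set lessThan_iff map_nth)
    then show "idx a < n" "r ! idx a = a"
      unfolding idx_def using inv_into_into[of a "(!) r" "{..<n}"] f_inv_into_f[of a "(!) r" "{..<n}"] by auto
  qed
  have "\<exists>ps. T (idx a) = elem_op ps" if "a < n" for a
    using T(1)[OF idx(1)[OF that]] by (simp add: elementary_def)
  then obtain ps where ps: "\<And>a. a < n \<Longrightarrow> elem_op (ps a) = T (idx a)" by metis
  have word: "elem_word ps v (y 0) = (if rev v = take (length v) r then y (length v) else 0)"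
    if "distinct v" "set v \<subseteq> {..<n}" for v
    using that
  proof (induction v)
    case (Cons a v)
    let ?m = "length v"
    have IH: "elem_word ps v (y 0) = (if rev v = take ?m r then y ?m else 0)"
      using Cons by simp
    have a: "a < n" "a \<notin> set v" using Cons.prems by auto
    have "card (set (a # v)) \<le> card {..<n}" using Cons.prems by (intro card_mono) auto
    then have m: "?m < n" using Cons.prems by (simp add: distinct_card)
    then have take_Suc: "take (Suc ?m) r = take ?m r @ [r ! ?m]" using r by (simp add: take_Suc_conv_app_nth)
    show ?case
    proof (cases "rev v = take ?m r")
      case False
      then show ?thesis using IH take_Suc m r by simp
    next
      case True
      have "\<not> idx a < ?m"
      proof
        assume "idx a < ?m"
        then have "a \<in> set (take ?m r)"
          using idx[OF a(1)] m r(3) by (auto simp: in_set_conv_nth intro!: exI[of _ "idx a"])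
        then show False using a(2) True by (metis set_rev)
      qed
      then have position: "idx a = ?m \<or> ?m < idx a" by linarith
      have "(r ! ?m = r ! idx a) = (?m = idx a)"
        by (rule nth_eq_iff_index_eq[OF r(1)]) (simp_all add: r(3) m idx(1)[OF a(1)])
      then have at_m: "(r ! ?m = a) = (?m = idx a)" unfolding idx(2)[OF a(1)] .
      have val: "elem_word ps (a # v) (y 0) = T (idx a) (y ?m)"
        using IH True ps[OF a(1)] by simp
      have rev_iff: "rev (a # v) = take (length (a # v)) r \<longleftrightarrow> ?m = idx a"
        using True take_Suc at_m by auto
      show ?thesis
        using position
      proof (elim disjE)
        assume "idx a = ?m"
        then show ?thesis using val rev_iff T(3)[OF m] by simp
      next
        assume "?m < idx a"
        then show ?thesis using val rev_iff T(2)[OF idx(1)[OF a(1)]] by simp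
      qed
    qed
  qed simp
  have "0 = (\<Sum>w\<in>perms n. of_int (\<beta> w) * elem_word ps w (y 0))"
    by (rule elementary_identity[OF two_sided, symmetric])
  also have "\<dots> = (\<Sum>w\<in>perms n. if w = w0 then of_int (\<beta> w0) * y n else 0)"
  proof (rule sum.cong[OF refl])
    fix w assume w: "w \<in> perms n"
    then have "rev w = take (length w) r \<longleftrightarrow> w = w0"
      using r(3) length_perms[OF w] by (simp add: r_def)
    then show "of_int (\<beta> w) * elem_word ps w (y 0) = (if w = w0 then of_int (\<beta> w0) * y n else 0)"
      using word[of w] w length_perms[OF w] by (auto simp: perms_iff)
  qed
  also have "\<dots> = of_int (\<beta> w0) * y n" using w0(1) by simp
  finally have "of_int (\<beta> w0) * y n = 0" by simp
  moreover have "of_int (\<beta> w0) \<in> (ring_centre :: 'a set)"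
    by (simp add: ring_centre_def mult_of_int_commute)
  ultimately have "y n = 0" using centre_left_cancel[OF prime _ w0(2)] by blast
  then show False using T(4) by simp
qed

section \<open>A trace on elementary operators\<close>

text \<open>This replaces passing to a common denominator.\<close>

lemma prime_common_multiple:
  fixes e :: "nat \<Rightarrow> 'a::ring_1"
  assumes prime: "prime_ring TYPE('a)" and "\<And>i. i < m \<Longrightarrow> e i \<noteq> 0"
  shows "\<exists>W p q. W \<noteq> 0 \<and> (\<forall>i<m. p i * e i * q i = W)"
  using assms(2)
proof (induction m)
  case 0
  have "(1::'a) \<noteq> 0" by simp
  then show ?case by blast
next
  case (Suc m)
  then obtain W p q where W: "W \<noteq> 0" "\<forall>i<m. p i * e i * q i = W" by auto
  obtain y where y: "W * y * e m \<noteq> 0"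
    using prime_ringD[OF prime, of W "e m"] W(1) Suc.prems[of m] by auto
  have "(p(m := W * y)) i * e i * ((\<lambda>i. q i * y * e m)(m := 1)) i = W * y * e m" if "i < Suc m" for i
  proof (cases "i = m")
    case False
    then have "p i * e i * q i = W" using W(2) that by auto
    then show ?thesis using False by (simp flip: mult.assoc)
  qed simp
  then show ?case using y by blast
qed

text \<open>Take a separating set \<open>a\<^sub>0, \<dots>, a\<^sub>m\<^sub>-\<^sub>1\<close> of least cardinality. Minimality yields
  operators with \<open>P\<^sub>i(a\<^sub>j) = \<delta>\<^sub>i\<^sub>j W\<close> for one \<open>W \<noteq> 0\<close>: a dual basis, up to the denominator
  \<open>W\<close>. The operator \<open>b \<mapsto> b z W - \<Sum>\<^sub>k a\<^sub>k z P\<^sub>k(b)\<close> kills every \<open>a\<^sub>j\<close> and is therefore zero,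
  which is the expansion of \<open>b\<close> in the basis. So \<open>tr(T) = \<Sum>\<^sub>i P\<^sub>i(T(a\<^sub>i))\<close> is the trace of \<open>T\<close>
  times \<open>W\<close>, and the usual computation gives \<open>tr(TS) = tr(ST)\<close>. It does not vanish on every
  \<open>x \<mapsto> u x v\<close>, since \<open>tr\<close> of \<open>P\<^sub>0\<close> followed by \<open>x \<mapsto> p x q\<close> is \<open>P\<^sub>0(p W q)\<close>, and \<open>P\<^sub>0\<close> is not zero
  on the ideal generated by \<open>W\<close>. Fixing such
  a \<open>v\<close>, let \<open>\<Phi>(x)\<close> be the trace of \<open>y \<mapsto> x y v\<close>.\<close>

lemma trace_form_exists:
  fixes X :: "'a::ring_1 set"
  assumes prime: "prime_ring TYPE('a)" and fin: "finite X"
    and sep: "separating X"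
  shows "\<exists>\<Phi>. elementary \<Phi> \<and> (\<exists>u. \<Phi> u \<noteq> (0::'a)) \<and> (\<forall>x y. \<Phi> (x * y) = \<Phi> (y * x))"
proof -
  have "finite X \<and> separating X" using fin sep by simp
  then obtain Y :: "'a set" where Y: "finite Y" "separating Y"
    and minimal: "\<And>Z :: 'a set. finite Z \<and> separating Z \<Longrightarrow> card Y \<le> card Z"
    using ex_has_least_nat[of "\<lambda>X. finite X \<and> separating X" X card] by blast
  note finY = Y(1)
  have sepY: "T x = 0" if "elementary T" "\<And>a. a \<in> Y \<Longrightarrow> T a = 0" for T x
    using Y(2) that unfolding separating_def by blast
  obtain as where as: "set as = Y" "distinct as" using finite_distinct_list[OF finY] by blast
  define m where "m = length as"
  define a where "a = (\<lambda>i. as ! i)"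
  have aY: "Y = a ` {..<m}" using as(1) by (auto simp: a_def m_def set_conv_nth)
  have a_inj: "a i = a j \<longleftrightarrow> i = j" if "i < m" "j < m" for i j
    using as(2) that by (simp add: a_def m_def nth_eq_iff_index_eq)
  have "\<exists>Q. elementary Q \<and> (\<forall>j<m. j \<noteq> i \<longrightarrow> Q (a j) = 0) \<and> Q (a i) \<noteq> 0" if "i < m" for i
  proof -
    have ai: "a i \<in> Y" using that aY by auto
    have "\<not> separating (Y - {a i})"
    proof
      assume "separating (Y - {a i})"
      then have "card Y \<le> card (Y - {a i})" using finY by (intro minimal) simp
      moreover have "card (Y - {a i}) < card Y" by (rule card_Diff1_less[OF finY ai])
      ultimately show False by simp
    qed
    then obtain T x where T: "elementary T" "\<And>b. b \<in> Y - {a i} \<Longrightarrow> T b = 0" "T x \<noteq> 0"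
      unfolding separating_def by blast
    have "T (a i) \<noteq> 0" using sepY[OF T(1)] T(2,3) by (metis DiffI singletonD)
    moreover have "T (a j) = 0" if "j < m" "j \<noteq> i" for j
      using T(2)[of "a j"] that a_inj \<open>i < m\<close> aY by auto
    ultimately show ?thesis using T(1) by blast
  qed
  then obtain Q where Q: "\<And>i. i < m \<Longrightarrow> elementary (Q i)"
    "\<And>i j. i < m \<Longrightarrow> j < m \<Longrightarrow> j \<noteq> i \<Longrightarrow> Q i (a j) = 0" "\<And>i. i < m \<Longrightarrow> Q i (a i) \<noteq> 0"
    by metis
  obtain W p q where W: "W \<noteq> 0" and pq: "\<And>i. i < m \<Longrightarrow> p i * Q i (a i) * q i = W"
    using prime_common_multiple[OF prime, of m "\<lambda>i. Q i (a i)"] Q(3) by blast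
  define P where "P = (\<lambda>i x. p i * Q i x * q i)"
  have P: "elementary (P i)" if "i < m" for i
    unfolding P_def using Q(1)[OF that] by (rule elementary_mult)
  have P_a: "P i (a j) = (if j = i then W else 0)" if "i < m" "j < m" for i j
    using that Q(2) pq by (auto simp: P_def)

  have expand: "b * z * W = (\<Sum>k<m. a k * z * P k b)" for b z
  proof -
    define E where "E = (\<lambda>b. 1 * b * (z * W) - (\<Sum>k<m. (a k * z) * P k b * 1))"
    have "elementary E"
      unfolding E_def
      by (intro elementary_diff elementary_sum elementary_mult[OF elementary_id] elementary_mult[OF P]) auto
    moreover have "E c = 0" if c: "c \<in> Y" for c
    proof -
      obtain j where j: "j < m" "c = a j" using c aY by auto
      have "(\<Sum>k<m. (a k * z) * P k c * 1) = (\<Sum>k<m. if k = j then a j * z * W else 0)"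
        by (rule sum.cong) (auto simp: j P_a)
      then show ?thesis using j by (simp add: E_def mult.assoc)
    qed
    ultimately have "E b = 0" by (rule sepY)
    then show ?thesis by (simp add: E_def mult.assoc)
  qed
  have expand_op: "R b * z * W = (\<Sum>k<m. R (a k) * z * P k b)" if R: "elementary R" for R b z
  proof -
    obtain rs where "R = elem_op rs" using R by (auto simp: elementary_def)
    moreover have "elem_op rs b * z * W = (\<Sum>k<m. elem_op rs (a k) * z * P k b)"
    proof (induction rs)
      case (Cons r rs)
      have "fst r * (b * (snd r * z) * W) = (\<Sum>k<m. fst r * a k * snd r * z * P k b)"
        unfolding expand by (simp add: sum_distrib_left mult.assoc)
      moreover have "elem_op (r # rs) b * z * W = fst r * (b * (snd r * z) * W) + elem_op rs b * z * W"
        by (simp add: algebra_simps)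
      ultimately show ?case
        using Cons.IH by (simp add: algebra_simps flip: sum.distrib)
    qed simp
    ultimately show ?thesis by simp
  qed
  \<comment> \<open>The values of \<open>P i\<close> are multiples of \<open>W\<close> by elements of the extended centroid, so they commute.\<close>
  have scalar: "P i b * z * W = W * z * P i b" if "i < m" for i b z
  proof -
    have "P i b * z * W = (\<Sum>k<m. P i (a k) * z * P k b)" by (rule expand_op[OF P[OF that]])
    also have "\<dots> = (\<Sum>k<m. if k = i then W * z * P i b else 0)"
      by (rule sum.cong) (auto simp: P_a that)
    finally show ?thesis using that by simp
  qed
  have cancel_W: "b = c" if "\<And>z. b * z * W = c * z * W" for b c
    using prime_ring_def[of "TYPE('a)"] prime W that
    by (metis (no_types, lifting) eq_iff_diff_eq_0 left_diff_distrib)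
  have commute: "P i b * z * P k c = P k c * z * P i b" if "i < m" "k < m" for i k b c z
  proof (rule cancel_W)
    fix y
    have "P i b * z * P k c * y * W = P i b * (z * P k c * y) * W" by (simp add: mult.assoc)
    also have "\<dots> = W * (z * P k c * y) * P i b" by (rule scalar[OF that(1)])
    also have "\<dots> = (W * z * P k c) * y * P i b" by (simp add: mult.assoc)
    also have "W * z * P k c = P k c * z * W" by (rule scalar[OF that(2), symmetric])
    also have "P k c * z * W * y * P i b = P k c * z * (W * y * P i b)" by (simp add: mult.assoc)
    also have "W * y * P i b = P i b * y * W" by (rule scalar[OF that(1), symmetric])
    finally show "P i b * z * P k c * y * W = P k c * z * P i b * y * W" by (simp add: mult.assoc)
  qed

  define tr where "tr = (\<lambda>T. \<Sum>i<m. P i (T (a i)))"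
  have tr_expand: "tr (\<lambda>x. T (S x)) * z * W = (\<Sum>i<m. \<Sum>k<m. P i (T (a k)) * z * P k (S (a i)))"
    if "elementary T" for T S z
    unfolding tr_def sum_distrib_right
    by (intro sum.cong refl expand_op elementary_comp[of "P _" T] P that) auto
  have tr_commute: "tr (\<lambda>x. T (S x)) = tr (\<lambda>x. S (T x))" if "elementary T" "elementary S" for T S
  proof (rule cancel_W)
    fix z
    have "tr (\<lambda>x. T (S x)) * z * W = (\<Sum>i<m. \<Sum>k<m. P k (S (a i)) * z * P i (T (a k)))"
      unfolding tr_expand[OF that(1)] by (intro sum.cong refl commute) auto
    also have "\<dots> = tr (\<lambda>x. S (T x)) * z * W"
      unfolding tr_expand[OF that(2)] by (rule sum.swap)
    finally show "tr (\<lambda>x. T (S x)) * z * W = tr (\<lambda>x. S (T x)) * z * W" .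
  qed
  have "\<exists>u v. tr (\<lambda>x. u * x * v) \<noteq> 0"
  proof (rule ccontr)
    assume "\<not> ?thesis"
    then have null: "tr (\<lambda>x. u * x * v) = 0" for u v by auto
    have null': "tr T = 0" if T: "elementary T" for T
    proof -
      obtain ps where "T = elem_op ps" using T by (auto simp: elementary_def)
      moreover have "tr (elem_op ps) = 0"
      proof (induction ps)
        case (Cons r rs)
        have "tr (elem_op (r # rs)) = tr (\<lambda>x. fst r * x * snd r) + tr (elem_op rs)"
          by (simp add: tr_def elementary_linear[OF P] sum.distrib)
        also have "\<dots> = 0" unfolding null Cons.IH by simp
        finally show ?case .
      qed (simp add: tr_def elementary_linear[OF P])
      ultimately show ?thesis by simp
    qed
    have "m \<noteq> 0"
    proof
      assume "m = 0"
      then have "(1::'a) = 0" using sepY[OF elementary_id, of 1] aY by auto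
      then show False by simp
    qed
    then have m: "0 < m" by simp
    have "P 0 (p * W * q) = 0" for p q
    proof -
      have "tr (\<lambda>x. p * P 0 x * q) = (\<Sum>i<m. if i = 0 then P 0 (p * W * q) else 0)"
        unfolding tr_def
        by (rule sum.cong) (auto simp: P_a m elementary_linear[OF P])
      then show ?thesis using null'[OF elementary_mult[OF P[OF m]]] m by simp
    qed
    then have "P 0 (a 0) = 0" by (rule elementary_vanish_ideal[OF prime P[OF m] W])
    then show False using P_a m W by simp
  qed
  then obtain u v where uv: "tr (\<lambda>x. u * x * v) \<noteq> 0" by blast
  define \<Phi> where "\<Phi> = (\<lambda>x. tr (\<lambda>y. x * y * v))"
  have "elementary (\<lambda>x. \<Sum>i<m. P i (1 * x * (a i * v)))"
    by (intro elementary_sum elementary_mult_arg P) auto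
  then have "elementary \<Phi>" by (simp add: \<Phi>_def tr_def mult.assoc)
  moreover have "\<Phi> (x * y) = \<Phi> (y * x)" for x y
  proof -
    have el: "elementary (\<lambda>z. x * z * 1)" "elementary (\<lambda>z. y * z * v)"
      by (rule elementary_mult[OF elementary_id])+
    show ?thesis
      using tr_commute[OF el] by (simp add: \<Phi>_def mult.assoc)
  qed
  ultimately show ?thesis using uv unfolding \<Phi>_def by blast
qed

section \<open>Finiteness over the centre\<close>

lemma elem_op_nth: "elem_op ps x = (\<Sum>i<length ps. fst (ps ! i) * x * snd (ps ! i))"
  by (simp add: elem_op_def case_prod_unfold sum_list_sum_nth atLeast0LessThan)

text \<open>Razmyslov's trick: the operator \<open>x \<mapsto> \<Phi>(x y) - \<Phi>(y x)\<close> is zero, and its flip is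
  \<open>x \<mapsto> y \<phi>(x) - \<phi>(x) y\<close> for the flip \<open>\<phi>\<close> of \<open>\<Phi>\<close>.\<close>

lemma trace_form_flip_central:
  fixes ps :: "('a::ring_1 \<times> 'a) list"
  assumes prime: "prime_ring TYPE('a)"
    and trace: "\<And>x y. elem_op ps (x * y) = elem_op ps (y * x)"
  shows "elem_op (map prod.swap ps) x \<in> ring_centre"
proof -
  have "elem_op (map prod.swap ps) x * y = y * elem_op (map prod.swap ps) x" for y
  proof -
    define qs where "qs = map (\<lambda>(a, b). (a, y * b)) ps @ map (\<lambda>(a, b). (- (a * y), b)) ps"
    have "elem_op qs z = elem_op ps (z * y) - elem_op ps (y * z)" for z
      unfolding qs_def elem_op_append
      by (induction ps) (auto simp: algebra_simps)
    then have "elem_op qs z = 0" for z using trace by simp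
    then have "elem_op (map prod.swap qs) x = 0" by (rule elem_op_flip[OF prime])
    moreover have "elem_op (map prod.swap qs) x
        = y * elem_op (map prod.swap ps) x - elem_op (map prod.swap ps) x * y"
      unfolding qs_def map_append elem_op_append
      by (induction ps) (auto simp: algebra_simps)
    ultimately show ?thesis by simp
  qed
  then show ?thesis by (simp add: ring_centre_def)
qed

text \<open>Let \<open>\<phi>(x) = \<Sum> b\<^sub>i x a\<^sub>i\<close> be the flip of \<open>\<Phi>(x) = \<Sum> a\<^sub>i x b\<^sub>i\<close>, which has central
  values. For all \<open>t, w\<close> the element \<open>c = \<Sum>\<^sub>j \<phi>(t a\<^sub>j w) b\<^sub>j\<close> satisfies
  \<open>c r = \<Sum>\<^sub>i \<phi>(r b\<^sub>i t) w a\<^sub>i\<close>: expand \<open>\<phi>(t a\<^sub>j w)\<close>, move it to the right of \<open>b\<^sub>j r\<close>, and sum over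
  \<open>j\<close> first. So \<open>c R\<close> lies in a finitely generated module over the centre. If \<open>\<Phi>\<close> has the least
  possible number of terms among the nonzero trace forms, then \<open>c \<noteq> 0\<close> for suitable \<open>t, w\<close>; and
  then some \<open>\<zeta> = \<phi>(p c q)\<close> is a nonzero central element with the same property.\<close>

lemma finite_over_centre:
  fixes \<Phi> :: "'a::ring_1 \<Rightarrow> 'a"
  assumes prime: "prime_ring TYPE('a)" and \<Phi>: "elementary \<Phi>" "\<Phi> u \<noteq> 0"
    and trace: "\<And>x y. \<Phi> (x * y) = \<Phi> (y * x)"
  shows "\<exists>\<zeta> (I :: (nat \<times> nat) set) g. \<zeta> \<in> ring_centre \<and> \<zeta> \<noteq> 0 \<and> finite I \<and>
    (\<forall>r. \<exists>c. (\<forall>i. c i \<in> ring_centre) \<and> \<zeta> * r = (\<Sum>i\<in>I. c i * (g i :: 'a)))"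
proof -
  define good where "good = (\<lambda>ps :: ('a \<times> 'a) list. (\<exists>u. elem_op ps u \<noteq> 0) \<and>
    (\<forall>x y. elem_op ps (x * y) = elem_op ps (y * x)))"
  have "\<exists>ps. good ps" using \<Phi> trace by (auto simp: good_def elementary_def)
  then obtain ps where "good ps" and minimal: "\<And>qs. good qs \<Longrightarrow> length ps \<le> length qs"
    using ex_has_least_nat[of good _ length] by blast
  then obtain u where u: "elem_op ps u \<noteq> 0"
    and tr: "\<And>x y. elem_op ps (x * y) = elem_op ps (y * x)" by (auto simp: good_def)
  define \<phi> where "\<phi> = elem_op (map prod.swap ps)"
  have central: "\<phi> x \<in> ring_centre" for x
    unfolding \<phi>_def by (rule trace_form_flip_central[OF prime tr])
  have \<phi>_el: "elementary \<phi>" by (auto simp: elementary_def \<phi>_def)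
  have \<phi>_ideal: "\<exists>p q. \<phi> (p * z * q) \<noteq> 0" if "z \<noteq> 0" for z
  proof (rule ccontr)
    assume "\<not> ?thesis"
    then have "elem_op (map prod.swap ps) x = 0" for x
      using elementary_vanish_ideal[OF prime \<phi>_el that] by (auto simp: \<phi>_def)
    from elem_op_flip[OF prime this, of u] show False using u by (simp add: comp_def)
  qed
  obtain u0 v0 qs where ps: "ps = (u0, v0) # qs" using u by (cases ps) auto
  have "u0 \<noteq> 0"
  proof
    assume "u0 = 0"
    then have "elem_op qs = elem_op ps" by (simp add: ps fun_eq_iff)
    then have "good qs" using \<open>good ps\<close> by (simp add: good_def)
    from minimal[OF this] show False by (simp add: ps)
  qed
  then obtain t w where tw: "\<phi> (t * u0 * w) \<noteq> 0" using \<phi>_ideal by blast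
  define c where "c = (\<Sum>(a, b)\<leftarrow>ps. \<phi> (t * a * w) * b)"
  have "c \<noteq> 0"
  proof
    assume c0: "c = 0"
    \<comment> \<open>The relation \<open>c = 0\<close> expresses \<open>z v0\<close> by the other right factors and so removes a term from \<open>z \<Phi>\<close>.\<close>
    define z where "z = \<phi> (t * u0 * w)"
    define rs where "rs = map (\<lambda>(a, b). (z * a - \<phi> (t * a * w) * u0, b)) qs"
    have rs: "elem_op rs x = z * elem_op ps x" for x
    proof -
      let ?S = "\<Sum>(a, b)\<leftarrow>qs. \<phi> (t * a * w) * u0 * x * b"
      have "u0 * x * c = z * u0 * x * v0 + (\<Sum>(a, b)\<leftarrow>qs. \<phi> (t * a * w) * u0 * x * b)"
      proof -
        have "u0 * x * (\<Sum>(a, b)\<leftarrow>l. \<phi> (t * a * w) * b) = (\<Sum>(a, b)\<leftarrow>l. \<phi> (t * a * w) * u0 * x * b)" for l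
          by (induction l)
            (auto simp: algebra_simps centre_commute[OF central])
        from this[of ps] show ?thesis by (simp add: c_def z_def ps)
      qed
      then have "- ?S = z * u0 * x * v0" using c0 by (simp add: neg_eq_iff_add_eq_0 add.commute)
      moreover have "elem_op rs x = z * elem_op qs x + - ?S"
        unfolding rs_def by (induction qs) (auto simp: algebra_simps)
      ultimately show ?thesis
        by (simp add: ps distrib_left mult.assoc)
    qed
    have "elem_op rs u \<noteq> 0"
      using centre_left_cancel[OF prime central tw, of "elem_op ps u"] u by (auto simp: rs z_def)
    then have "good rs" using tr rs by (auto simp: good_def)
    from minimal[OF this] show False by (simp add: ps rs_def)
  qed
  then obtain p q where pq: "\<phi> (p * c * q) \<noteq> 0" using \<phi>_ideal by blast
  define L where "L = length ps"
  define a where "a = (\<lambda>i. fst (ps ! i))"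
  define b where "b = (\<lambda>i. snd (ps ! i))"
  have \<phi>: "\<phi> x = (\<Sum>i<L. b i * x * a i)" for x
    by (simp add: \<phi>_def elem_op_nth L_def a_def b_def)
  have c: "c = (\<Sum>i<L. \<phi> (t * a i * w) * b i)"
    by (simp add: c_def case_prod_unfold sum_list_sum_nth atLeast0LessThan L_def a_def b_def)
  have c_mult: "c * r = (\<Sum>i<L. \<phi> (r * b i * t) * w * a i)" for r
  proof -
    have "c * r = (\<Sum>j<L. b j * r * \<phi> (t * a j * w))"
      unfolding c sum_distrib_right
      by (intro sum.cong refl) (simp add: centre_commute[OF central] mult.assoc)
    also have "\<dots> = (\<Sum>j<L. \<Sum>i<L. b j * (r * b i * t) * a j * w * a i)"
      unfolding \<phi> sum_distrib_left by (simp add: mult.assoc)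
    also have "\<dots> = (\<Sum>i<L. \<Sum>j<L. b j * (r * b i * t) * a j * w * a i)"
      by (rule sum.swap)
    also have "\<dots> = (\<Sum>i<L. \<phi> (r * b i * t) * w * a i)"
      unfolding \<phi> sum_distrib_right ..
    finally show ?thesis .
  qed
  have "\<phi> (p * c * q) * r = (\<Sum>(j, i)\<in>{..<L} \<times> {..<L}. \<phi> (q * a j * r * b i * t) * (b j * p * w * a i))" for r
  proof -
    have "\<phi> (p * c * q) * r = (\<Sum>j<L. b j * p * (c * (q * a j * r)))"
      unfolding \<phi>[of "p * c * q"] sum_distrib_right by (simp add: mult.assoc)
    also have "\<dots> = (\<Sum>j<L. \<Sum>i<L. b j * p * \<phi> (q * a j * r * b i * t) * w * a i)"
      unfolding c_mult sum_distrib_left by (simp add: mult.assoc)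
    also have "\<dots> = (\<Sum>j<L. \<Sum>i<L. \<phi> (q * a j * r * b i * t) * (b j * p * w * a i))"
    proof (intro sum.cong refl)
      fix j i
      have "b j * p * \<phi> (q * a j * r * b i * t) = \<phi> (q * a j * r * b i * t) * (b j * p)"
        by (rule centre_commute[OF central, symmetric])
      then show "b j * p * \<phi> (q * a j * r * b i * t) * w * a i
          = \<phi> (q * a j * r * b i * t) * (b j * p * w * a i)"
        by (simp add: mult.assoc)
    qed
    finally show ?thesis by (simp add: sum.cartesian_product)
  qed
  then have "\<exists>cf. (\<forall>i. cf i \<in> ring_centre) \<and>
      \<phi> (p * c * q) * r = (\<Sum>i\<in>{..<L} \<times> {..<L}. cf i * (case i of (j, i) \<Rightarrow> b j * p * w * a i))" for r
    by (intro exI[of _ "\<lambda>(j, i). \<phi> (q * a j * r * b i * t)"]) (auto simp: central case_prod_unfold)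
  then show ?thesis
    using central[of "p * c * q"] pq
    by (intro exI[of _ "\<phi> (p * c * q)"] exI[of _ "{..<L} \<times> {..<L}"]
        exI[of _ "\<lambda>(j, i). b j * p * w * a i"]) auto
qed

section \<open>Noetherian centres\<close>

lemma centre_closed:
  "(0::'a::ring_1) \<in> ring_centre" "(1::'a) \<in> ring_centre"
  "x \<in> ring_centre \<Longrightarrow> y \<in> ring_centre \<Longrightarrow> x + y \<in> (ring_centre :: 'a set)"
  "x \<in> ring_centre \<Longrightarrow> y \<in> ring_centre \<Longrightarrow> x * y \<in> (ring_centre :: 'a set)"
  "x \<in> ring_centre \<Longrightarrow> - x \<in> (ring_centre :: 'a set)"
  "x \<in> ring_centre \<Longrightarrow> y \<in> ring_centre \<Longrightarrow> x - y \<in> (ring_centre :: 'a set)"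
proof -
  interpret cring "centre_ring TYPE('a)" by (rule cring_centre_ring)
  show "(0::'a) \<in> ring_centre" "(1::'a) \<in> ring_centre"
    using zero_closed one_closed by (simp_all add: centre_ring_def)
  show "x \<in> ring_centre \<Longrightarrow> y \<in> ring_centre \<Longrightarrow> x + y \<in> (ring_centre :: 'a set)"
    "x \<in> ring_centre \<Longrightarrow> y \<in> ring_centre \<Longrightarrow> x * y \<in> (ring_centre :: 'a set)"
    using add.m_closed[of x y] m_closed[of x y] by (simp_all add: centre_ring_def)
  show minus: "x \<in> ring_centre \<Longrightarrow> - x \<in> (ring_centre :: 'a set)" for x
    by (simp add: ring_centre_def)
  show "x - y \<in> (ring_centre :: 'a set)" if "x \<in> ring_centre" "y \<in> ring_centre"
    using that by (simp add: ring_centre_def left_diff_distrib right_diff_distrib)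
qed

lemma centre_sum: "(\<And>i. i \<in> I \<Longrightarrow> f i \<in> ring_centre) \<Longrightarrow> (\<Sum>i\<in>I. f i) \<in> (ring_centre :: 'a::ring_1 set)"
  by (induction I rule: infinite_finite_induct) (auto simp: centre_closed)

text \<open>The ideals generated by the initial segments of the sequence form an ascending chain.\<close>

lemma noetherian_centre_sequence:
  fixes a :: "nat \<Rightarrow> 'a::ring_1"
  assumes noeth: "noetherian_ring (centre_ring TYPE('a))" and a: "\<And>k. a k \<in> ring_centre"
  shows "\<exists>k0. \<forall>k. \<exists>c. (\<forall>i. c i \<in> ring_centre) \<and> a k = (\<Sum>i<k0. c i * a i)"
proof -
  let ?R = "centre_ring TYPE('a)"
  interpret noetherian_ring ?R by (rule noeth)
  define J where "J = (\<lambda>k. {\<Sum>i<k. c i * a i | c. \<forall>i. c i \<in> (ring_centre :: 'a set)})"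
  have JI: "(\<Sum>i<k. c i * a i) \<in> J k" if "\<And>i. c i \<in> ring_centre" for c k
    using that by (auto simp: J_def)
  have J_sub: "J k \<subseteq> ring_centre" for k
    by (auto simp: J_def intro!: centre_sum centre_closed a)
  have J_mult: "x * y \<in> J k" if x: "x \<in> ring_centre" and y: "y \<in> J k" for x y k
  proof -
    obtain c where c: "\<And>i. c i \<in> ring_centre" "y = (\<Sum>i<k. c i * a i)" using y by (auto simp: J_def)
    have "(\<Sum>i<k. x * c i * a i) \<in> J k" using c(1) x by (intro JI centre_closed)
    then show ?thesis by (simp add: c(2) sum_distrib_left mult.assoc)
  qed
  have J_add: "x + y \<in> J k" if x: "x \<in> J k" and y: "y \<in> J k" for x y k
  proof -
    obtain c where c: "\<And>i. c i \<in> ring_centre" "x = (\<Sum>i<k. c i * a i)" using x by (auto simp: J_def)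
    obtain d where d: "\<And>i. d i \<in> ring_centre" "y = (\<Sum>i<k. d i * a i)" using y by (auto simp: J_def)
    have "(\<Sum>i<k. (c i + d i) * a i) \<in> J k" using c(1) d(1) by (intro JI centre_closed)
    then show ?thesis by (simp add: c(2) d(2) sum.distrib distrib_right)
  qed
  have carr: "carrier ?R = ring_centre" by (simp add: centre_ring_def)
  have "ideal (J k) ?R" for k
  proof (rule idealI[OF ring_axioms])
    show "subgroup (J k) (add_monoid ?R)"
    proof (rule add.subgroupI)
      show "J k \<subseteq> carrier ?R" using J_sub carr by simp
      show "J k \<noteq> {}" using JI[of "\<lambda>_. 0"] centre_closed(1) by blast
      fix x y assume x: "x \<in> J k" and "y \<in> J k"
      then show "x \<oplus>\<^bsub>?R\<^esub> y \<in> J k" using J_add by (simp add: centre_ring_def)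
      have "x \<in> ring_centre" using x J_sub by blast
      then have "\<ominus>\<^bsub>?R\<^esub> x = - x"
        by (intro minus_equality) (simp_all add: centre_ring_def centre_closed)
      then show "\<ominus>\<^bsub>?R\<^esub> x \<in> J k"
        using J_mult[of "- 1" x k] x by (simp add: centre_closed)
    qed
  next
    fix x y assume xy: "x \<in> J k" "y \<in> carrier ?R"
    then show "y \<otimes>\<^bsub>?R\<^esub> x \<in> J k" using J_mult carr by (simp add: centre_ring_def)
    moreover have "x \<in> ring_centre" using xy(1) J_sub by blast
    ultimately show "x \<otimes>\<^bsub>?R\<^esub> y \<in> J k"
      using centre_commute[of x y] by (simp add: centre_ring_def)
  qed
  moreover have "J k \<subseteq> J l" if "k \<le> l" for k l
  proof
    fix x assume "x \<in> J k"
    then obtain c where c: "\<And>i. c i \<in> ring_centre" "x = (\<Sum>i<k. c i * a i)" by (auto simp: J_def)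
    have "x = (\<Sum>i<l. (if i < k then c i else 0) * a i)"
      unfolding c(2) using that by (intro sum.mono_neutral_cong_left) auto
    also have "\<dots> \<in> J l" by (rule JI) (simp add: c(1) centre_closed(1))
    finally show "x \<in> J l" .
  qed
  ultimately have "subset.chain {I. ideal I ?R} (range J)"
    by (auto simp: subset_chain_def) (meson nat_le_linear subsetD)
  then have "\<Union> (range J) \<in> range J" by (intro ideal_chain_is_trivial) auto
  then obtain k0 where k0: "\<Union> (range J) = J k0" by auto
  have "a k \<in> J k0" for k
  proof -
    have "a k = (\<Sum>i<Suc k. (if i = k then 1 else 0) * a i)" by simp
    moreover have "(\<Sum>i<Suc k. (if i = k then 1 else 0) * a i) \<in> J (Suc k)"
      by (rule JI) (simp add: centre_closed)
    ultimately show ?thesis using k0 by (metis UN_I UNIV_I)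
  qed
  then show ?thesis by (intro exI[of _ k0]) (auto simp: J_def)
qed

text \<open>A free module of finite rank over a Noetherian ring is Noetherian, in the form needed for
  recurrences: some member of every sequence of vectors is a combination of the earlier ones. By
  induction on the rank: from some point on, all values at the coordinate \<open>i\<^sub>0\<close> are combinations of
  finitely many early ones; subtracting these combinations gives a sequence that vanishes at \<open>i\<^sub>0\<close>.\<close>

lemma noetherian_centre_vectors:
  fixes v :: "nat \<Rightarrow> 'i \<Rightarrow> 'a::ring_1"
  assumes noeth: "noetherian_ring (centre_ring TYPE('a))" and "finite I"
    and "\<And>k i. i \<in> I \<Longrightarrow> v k i \<in> ring_centre"
  shows "\<exists>k c. (\<forall>j. c j \<in> ring_centre) \<and> (\<forall>i\<in>I. v k i = (\<Sum>j<k. c j * v j i))"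
  using assms(2,3)
proof (induction I arbitrary: v rule: finite_induct)
  case empty
  show ?case by (intro exI[of _ 0] exI[of _ "\<lambda>_. 0"]) (simp add: centre_closed)
next
  case (insert i0 I)
  have "v k i0 \<in> ring_centre" for k using insert.prems by simp
  from noetherian_centre_sequence[OF noeth, of "\<lambda>k. v k i0", OF this]
  obtain k0 where k0: "\<forall>k. \<exists>c. (\<forall>i. c i \<in> ring_centre) \<and> v k i0 = (\<Sum>j<k0. c j * v j i0)" by (elim exE)
  define C where "C = (\<lambda>k. SOME c. (\<forall>i. c i \<in> ring_centre) \<and> v k i0 = (\<Sum>j<k0. c j * v j i0))"
  have CC: "(\<forall>i. C k i \<in> ring_centre) \<and> v k i0 = (\<Sum>j<k0. C k j * v j i0)" for k
    unfolding C_def by (rule someI_ex[OF spec[OF k0]])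
  have C: "C k i \<in> ring_centre" "v k i0 = (\<Sum>j<k0. C k j * v j i0)" for k i
    by (rule CC[THEN conjunct1, THEN spec], rule CC[THEN conjunct2])
  define w where "w = (\<lambda>k i. v (k0 + k) i - (\<Sum>j<k0. C (k0 + k) j * v j i))"
  have w0: "w k i0 = 0" for k
    unfolding w_def using C(2)[of "k0 + k"] by (rule eq_iff_diff_eq_0[THEN iffD1])
  have w_centre: "w k i \<in> ring_centre" if "i \<in> I" for k i
    unfolding w_def using insert.prems that C(1) by (intro centre_closed centre_sum) auto
  have "\<exists>k c. (\<forall>j. c j \<in> ring_centre) \<and> (\<forall>i\<in>I. w k i = (\<Sum>j<k. c j * w j i))"
    by (rule insert.IH) (rule w_centre)
  then obtain k c where kc: "(\<forall>j. c j \<in> ring_centre) \<and> (\<forall>i\<in>I. w k i = (\<Sum>j<k. c j * w j i))"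
    by (elim exE)
  have c: "c j \<in> ring_centre" for j by (rule kc[THEN conjunct1, THEN spec])
  have w_rel: "w k i = (\<Sum>j<k. c j * w j i)" if "i \<in> I" for i
    by (rule kc[THEN conjunct2, THEN bspec, OF that])
  define c' where "c' = (\<lambda>m. if m < k0 then C (k0 + k) m - (\<Sum>j<k. c j * C (k0 + j) m) else c (m - k0))"
  have "c' m \<in> ring_centre" for m
    using C(1) c by (auto simp: c'_def intro!: centre_closed centre_sum)
  moreover have "v (k0 + k) i = (\<Sum>m<k0 + k. c' m * v m i)" if i: "i \<in> insert i0 I" for i
  proof -
    have split: "(\<Sum>m<k0 + l. f m) = (\<Sum>m<k0. f m) + (\<Sum>j<l. f (k0 + j))" for f :: "nat \<Rightarrow> 'a" and l
      by (induction l) (auto simp: add.assoc)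
    have "w k i = (\<Sum>j<k. c j * w j i)"
      using i w_rel[of i] w0 by (cases "i = i0") auto
    then have "v (k0 + k) i = (\<Sum>m<k0. C (k0 + k) m * v m i)
        + (\<Sum>j<k. c j * (v (k0 + j) i - (\<Sum>m<k0. C (k0 + j) m * v m i)))"
      unfolding w_def by (simp add: diff_eq_eq add.commute)
    also have "(\<Sum>j<k. c j * (v (k0 + j) i - (\<Sum>m<k0. C (k0 + j) m * v m i)))
        = (\<Sum>j<k. c j * v (k0 + j) i) - (\<Sum>j<k. \<Sum>m<k0. c j * C (k0 + j) m * v m i)"
      by (simp add: right_diff_distrib sum_subtractf sum_distrib_left mult.assoc)
    also have "(\<Sum>j<k. \<Sum>m<k0. c j * C (k0 + j) m * v m i) = (\<Sum>m<k0. (\<Sum>j<k. c j * C (k0 + j) m) * v m i)"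
      unfolding sum_distrib_right by (rule sum.swap)
    also have "(\<Sum>m<k0. C (k0 + k) m * v m i) + ((\<Sum>j<k. c j * v (k0 + j) i)
          - (\<Sum>m<k0. (\<Sum>j<k. c j * C (k0 + j) m) * v m i))
        = (\<Sum>m<k0. c' m * v m i) + (\<Sum>j<k. c' (k0 + j) * v (k0 + j) i)"
      by (simp add: c'_def left_diff_distrib sum_subtractf)
    finally show ?thesis unfolding split .
  qed
  ultimately show ?case by (intro exI[of _ "k0 + k"] exI[of _ c'] conjI allI ballI)
qed

section \<open>Invertible matrices\<close>

lemma mult_mat_central_smult:
  fixes A B :: "'a::ring_1 mat"
  assumes c: "c \<in> ring_centre" and AB: "A \<in> carrier_mat n n" "B \<in> carrier_mat n n"
  shows "A * (c \<cdot>\<^sub>m B) = c \<cdot>\<^sub>m (A * B)"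
proof (rule eq_matI)
  fix i j assume ij: "i < dim_row (c \<cdot>\<^sub>m (A * B))" "j < dim_col (c \<cdot>\<^sub>m (A * B))"
  have "x * (c * y) = c * (x * y)" for x y
    using centre_commute[OF c, of x] by (simp flip: mult.assoc)
  then show "(A * (c \<cdot>\<^sub>m B)) $$ (i, j) = (c \<cdot>\<^sub>m (A * B)) $$ (i, j)"
    using AB ij by (simp add: scalar_prod_def sum_distrib_left)
qed (use AB in auto)

lemma smult_one_mult_mat:
  fixes A :: "'a::ring_1 mat"
  assumes A: "A \<in> carrier_mat n n"
  shows "(c \<cdot>\<^sub>m 1\<^sub>m n) * A = c \<cdot>\<^sub>m A"
proof (rule eq_matI)
  fix i j assume ij: "i < dim_row (c \<cdot>\<^sub>m A)" "j < dim_col (c \<cdot>\<^sub>m A)"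
  have "((c \<cdot>\<^sub>m 1\<^sub>m n) * A) $$ (i, j) = (\<Sum>k<n. (c * (if k = i then 1 else 0)) * A $$ (k, j))"
    using A ij by (simp add: scalar_prod_def atLeast0LessThan)
  also have "\<dots> = (\<Sum>k<n. if k = i then c * A $$ (i, j) else 0)"
    by (rule sum.cong) auto
  finally show "((c \<cdot>\<^sub>m 1\<^sub>m n) * A) $$ (i, j) = (c \<cdot>\<^sub>m A) $$ (i, j)"
    using A ij by simp
qed (use A in auto)

text \<open>The entries of \<open>\<zeta> V\<^sup>k\<close> have coordinates over the centre with respect to the finitely many
  \<open>g\<^sub>i\<close>. A linear relation between coordinate vectors is one between the matrices, and \<open>\<zeta>\<close>
  cancels.\<close>

lemma inverse_mat_power_relation:
  fixes V :: "'a::ring_1 mat"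
  assumes prime: "prime_ring TYPE('a)" and noeth: "noetherian_ring (centre_ring TYPE('a))"
    and \<zeta>: "\<zeta> \<in> ring_centre" "\<zeta> \<noteq> 0" and "finite I"
    and gen: "\<And>r. \<exists>c. (\<forall>i. c i \<in> ring_centre) \<and> \<zeta> * r = (\<Sum>i\<in>I. c i * (g i :: 'a))"
  shows "\<exists>k c. (\<forall>l. c l \<in> ring_centre) \<and>
    (\<forall>i<n. \<forall>j<n. (V ^\<^sub>m k) $$ (i, j) = (\<Sum>l<k. c l * (V ^\<^sub>m l) $$ (i, j)))"
proof -
  define coord where "coord = (\<lambda>r. SOME c. (\<forall>i. c i \<in> ring_centre) \<and> \<zeta> * r = (\<Sum>i\<in>I. c i * g i))"
  have co: "(\<forall>i. coord r i \<in> ring_centre) \<and> \<zeta> * r = (\<Sum>i\<in>I. coord r i * g i)" for r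
    unfolding coord_def by (rule someI_ex[OF gen])
  have coord: "coord r i \<in> ring_centre" "\<zeta> * r = (\<Sum>i\<in>I. coord r i * g i)" for r i
    by (rule co[THEN conjunct1, THEN spec], rule co[THEN conjunct2])
  define v where "v = (\<lambda>k ((i, j), t). coord ((V ^\<^sub>m k) $$ (i, j)) t)"
  let ?D = "({..<n} \<times> {..<n}) \<times> I"
  have "\<exists>k c. (\<forall>l. c l \<in> ring_centre) \<and> (\<forall>d\<in>?D. v k d = (\<Sum>l<k. c l * v l d))"
    by (rule noetherian_centre_vectors[OF noeth])
      (auto simp: v_def coord assms(5) intro!: finite_cartesian_product)
  then obtain k c where kc: "(\<forall>l. c l \<in> ring_centre) \<and> (\<forall>d\<in>?D. v k d = (\<Sum>l<k. c l * v l d))"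
    by (elim exE)
  have c: "c l \<in> ring_centre" for l by (rule kc[THEN conjunct1, THEN spec])
  have v_rel: "v k d = (\<Sum>l<k. c l * v l d)" if "d \<in> ?D" for d
    by (rule kc[THEN conjunct2, THEN bspec, OF that])
  have "(V ^\<^sub>m k) $$ (i, j) = (\<Sum>l<k. c l * (V ^\<^sub>m l) $$ (i, j))" if "i < n" "j < n" for i j
  proof -
    let ?e = "\<lambda>l. (V ^\<^sub>m l) $$ (i, j)"
    have "\<zeta> * ?e k = (\<Sum>t\<in>I. v k ((i, j), t) * g t)" by (simp add: v_def coord(2))
    also have "\<dots> = (\<Sum>t\<in>I. \<Sum>l<k. c l * (v l ((i, j), t) * g t))"
    proof (intro sum.cong refl)
      fix t assume "t \<in> I"
      then have "v k ((i, j), t) = (\<Sum>l<k. c l * v l ((i, j), t))"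
        using that by (intro v_rel) simp
      then show "v k ((i, j), t) * g t = (\<Sum>l<k. c l * (v l ((i, j), t) * g t))"
        by (simp only: sum_distrib_right mult.assoc)
    qed
    also have "\<dots> = (\<Sum>l<k. \<Sum>t\<in>I. c l * (v l ((i, j), t) * g t))"
      by (rule sum.swap)
    also have "\<dots> = (\<Sum>l<k. c l * (\<zeta> * ?e l))"
      by (intro sum.cong refl) (simp add: v_def coord(2) sum_distrib_left)
    also have "\<dots> = (\<Sum>l<k. \<zeta> * (c l * ?e l))"
    proof (intro sum.cong refl)
      fix l
      have "c l * (\<zeta> * ?e l) = (c l * \<zeta>) * ?e l" by (rule mult.assoc[symmetric])
      also have "c l * \<zeta> = \<zeta> * c l" by (rule centre_commute[OF \<zeta>(1), symmetric])
      finally show "c l * (\<zeta> * ?e l) = \<zeta> * (c l * ?e l)" by (simp only: mult.assoc)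
    qed
    finally have "\<zeta> * (?e k - (\<Sum>l<k. c l * ?e l)) = 0"
      by (simp add: right_diff_distrib sum_distrib_left)
    then have "?e k - (\<Sum>l<k. c l * ?e l) = 0" by (rule centre_left_cancel[OF prime \<zeta>])
    then show ?thesis by simp
  qed
  then show ?thesis using c by (intro exI[of _ k] exI[of _ c] conjI allI impI)
qed

lemma pow_mat_cancel_inverse:
  fixes U V :: "'a::semiring_1 mat"
  assumes UV: "U \<in> carrier_mat n n" "V \<in> carrier_mat n n" "U * V = 1\<^sub>m n"
  shows "U ^\<^sub>m (p + m) * V ^\<^sub>m m = U ^\<^sub>m p"
proof (induction m arbitrary: p)
  case 0
  then show ?case using UV by (simp add: pow_carrier_mat)
next
  case (Suc m)
  have "U ^\<^sub>m (p + Suc m) * V ^\<^sub>m Suc m = U ^\<^sub>m (Suc p + m) * (V ^\<^sub>m m * V)" by simp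
  also have "\<dots> = (U ^\<^sub>m (Suc p + m) * V ^\<^sub>m m) * V"
    by (rule assoc_mult_mat[symmetric]) (rule pow_carrier_mat UV(1,2))+
  also have "\<dots> = U ^\<^sub>m Suc p * V" unfolding Suc.IH ..
  also have "\<dots> = U ^\<^sub>m p * (U * V)"
    unfolding pow_mat.simps by (rule assoc_mult_mat) (rule pow_carrier_mat UV(1,2))+
  finally show ?case using UV by (simp add: pow_carrier_mat)
qed

text \<open>Multiplying \<open>V\<^sup>k = \<Sum> c\<^sub>l V\<^sup>l\<close>, where \<open>l < k\<close>, by \<open>U\<^sup>k\<^sup>-\<^sup>1\<close> expresses \<open>V\<close> as a
  polynomial in \<open>U\<close> with central coefficients.\<close>

lemma inverse_mem_subring:
  fixes U V :: "'a::ring_1 mat"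
  assumes S: "subring S (ring_mat TYPE('a) n ())"
    and scalars: "{r \<cdot>\<^sub>m 1\<^sub>m n | r. r \<in> (ring_centre :: 'a set)} \<subseteq> S"
    and U: "U \<in> S" and V: "V \<in> carrier_mat n n" "U * V = 1\<^sub>m n"
    and c: "\<And>l. c l \<in> ring_centre"
    and rel: "\<And>i j. i < n \<Longrightarrow> j < n \<Longrightarrow> (V ^\<^sub>m k) $$ (i, j) = (\<Sum>l<k. c l * (V ^\<^sub>m l) $$ (i, j))"
  shows "V \<in> S"
proof -
  have sub: "S \<subseteq> carrier_mat n n" and one: "1\<^sub>m n \<in> S" and zero: "0\<^sub>m n n \<in> S"
    and mult: "\<And>A B. A \<in> S \<Longrightarrow> B \<in> S \<Longrightarrow> A * B \<in> S" and add: "\<And>A B. A \<in> S \<Longrightarrow> B \<in> S \<Longrightarrow> A + B \<in> S"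
    using subringE[OF S] by (simp_all add: ring_mat_simps)
  have UC: "U \<in> carrier_mat n n" using U sub by blast
  have pow: "U ^\<^sub>m l \<in> S" for l
    using UC by (induction l) (auto simp: one intro: mult U)
  \<comment> \<open>Partial sums of the relation; their products with a power of \<open>U\<close> stay in \<open>S\<close>.\<close>
  define X where "X = (\<lambda>m. mat n n (\<lambda>(i, j). \<Sum>l<m. c l * (V ^\<^sub>m l) $$ (i, j)))"
  have X: "X m \<in> carrier_mat n n" for m by (simp add: X_def)
  have X_Suc: "X (Suc m) = X m + c m \<cdot>\<^sub>m V ^\<^sub>m m" for m
    using pow_carrier_mat[OF V(1), of m] by (intro eq_matI) (auto simp: X_def simp del: pow_mat_dim)
  have Xk: "X k = V ^\<^sub>m k"
    using pow_carrier_mat[OF V(1), of k] rel by (intro eq_matI) (auto simp: X_def simp del: pow_mat_dim)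
  show ?thesis
  proof (cases k)
    case 0
    \<comment> \<open>The relation then reads \<open>1 = 0\<close>, so the matrices are empty.\<close>
    have "i < n \<Longrightarrow> j < n \<Longrightarrow> (1\<^sub>m n :: 'a mat) $$ (i, j) = 0" for i j
      using rel[of i j] V(1) by (simp add: 0)
    from this[of 0 0] have "n = 0" by auto
    then have "V = 1\<^sub>m n" using V(1) by (intro eq_matI) auto
    then show ?thesis using one by simp
  next
    case (Suc p)
    have "U ^\<^sub>m p * X m \<in> S" if "m \<le> Suc p" for m
      using that
    proof (induction m)
      case 0
      have "X 0 = 0\<^sub>m n n" by (intro eq_matI) (auto simp: X_def)
      then show ?case using zero UC by (simp add: pow_carrier_mat right_mult_zero_mat[of _ n n])
    next
      case (Suc m)
      have Vm: "V ^\<^sub>m m \<in> carrier_mat n n" and Up: "U ^\<^sub>m p \<in> carrier_mat n n"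
        using V(1) UC by (auto simp: pow_carrier_mat)
      have "U ^\<^sub>m p * X (Suc m) = U ^\<^sub>m p * X m + U ^\<^sub>m p * (c m \<cdot>\<^sub>m V ^\<^sub>m m)"
        unfolding X_Suc using Vm by (intro mult_add_distrib_mat[OF Up X]) simp
      also have "U ^\<^sub>m p * (c m \<cdot>\<^sub>m V ^\<^sub>m m) = c m \<cdot>\<^sub>m (U ^\<^sub>m (p - m + m) * V ^\<^sub>m m)"
        using mult_mat_central_smult[OF c Up Vm] Suc.prems by simp
      also have "\<dots> = c m \<cdot>\<^sub>m U ^\<^sub>m (p - m)"
        unfolding pow_mat_cancel_inverse[OF UC V] ..
      also have "\<dots> = (c m \<cdot>\<^sub>m 1\<^sub>m n) * U ^\<^sub>m (p - m)"
        using UC by (intro smult_one_mult_mat[symmetric]) (simp add: pow_carrier_mat)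
      finally have eq: "U ^\<^sub>m p * X (Suc m) = U ^\<^sub>m p * X m + (c m \<cdot>\<^sub>m 1\<^sub>m n) * U ^\<^sub>m (p - m)" .
      have scalar: "c m \<cdot>\<^sub>m 1\<^sub>m n \<in> S" using scalars c by blast
      have IH: "U ^\<^sub>m p * X m \<in> S" using Suc by simp
      show ?case unfolding eq by (rule add[OF IH mult[OF scalar pow]])
    qed
    from this[of "Suc p"] have "U ^\<^sub>m p * V ^\<^sub>m Suc p \<in> S" using Xk Suc by simp
    also have "U ^\<^sub>m p * V ^\<^sub>m Suc p = (U ^\<^sub>m (0 + p) * V ^\<^sub>m p) * V"
      unfolding pow_mat.simps add_0
      by (rule assoc_mult_mat[symmetric]) (rule pow_carrier_mat UC V(1))+
    also have "\<dots> = V"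
      unfolding pow_mat_cancel_inverse[OF UC V] using UC V(1) by simp
    finally show ?thesis .
  qed
qed

theorem theorem2p5:
  fixes n :: nat and S :: "'a::ring_1 mat set"
  assumes "prime_ring TYPE('a)"
    and "PI_ring TYPE('a)"
    and "noetherian_ring (centre_ring TYPE('a))"
    and "n \<ge> 1"
    and "subring S (ring_mat TYPE('a) n ())"
    and "{r \<cdot>\<^sub>m 1\<^sub>m n | r. r \<in> (ring_centre :: 'a set)} \<subseteq> S"
  shows "S \<inter> Units (ring_mat TYPE('a) n ()) = Units ((ring_mat TYPE('a) n ())\<lparr>carrier := S\<rparr>)"
proof -
  let ?M = "ring_mat TYPE('a) n ()"
  obtain d \<alpha> where identity: "multilinear_identity TYPE('a) d \<alpha>" "\<alpha> [0..<d] = 1"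
    using PI_ring_multilinear[OF assms(2)] by blast
  \<comment> \<open>In degree \<open>0\<close> the identity would say \<open>1 = 0\<close>.\<close>
  have "d \<noteq> 0"
  proof
    assume "d = 0"
    then have "(\<Sum>w\<in>perms 0. of_int (\<alpha> w) * prod_list (map (\<lambda>_. 0 :: 'a) w)) = 0" "\<alpha> [] = 1"
      using identity by (simp_all add: multilinear_identity_def)
    moreover have "perms 0 = {[]}" by simp
    ultimately show False by simp
  qed
  then obtain d' where d': "d = Suc d'" using not0_implies_Suc by blast
  obtain X :: "'a set" where X: "finite X \<and> separating X"
    using finite_separating_set[OF assms(1) identity[unfolded d']] by (elim exE)
  obtain \<Phi> where \<Phi>: "elementary \<Phi> \<and> (\<exists>u. \<Phi> u \<noteq> (0::'a)) \<and> (\<forall>x y. \<Phi> (x * y) = \<Phi> (y * x))"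
    using trace_form_exists[OF assms(1) conjunct1[OF X] conjunct2[OF X]] by (elim exE)
  then obtain u where u: "\<Phi> u \<noteq> 0" by blast
  have trace: "\<Phi> (x * y) = \<Phi> (y * x)" for x y using \<Phi> by blast
  obtain \<zeta> g and I :: "(nat \<times> nat) set" where fin: "\<zeta> \<in> ring_centre \<and> \<zeta> \<noteq> (0::'a) \<and> finite I \<and>
    (\<forall>r. \<exists>c. (\<forall>i. c i \<in> ring_centre) \<and> \<zeta> * r = (\<Sum>i\<in>I. c i * (g i :: 'a)))"
    using finite_over_centre[OF assms(1) conjunct1[OF \<Phi>] u trace] by (elim exE)
  have \<zeta>: "\<zeta> \<in> ring_centre" "\<zeta> \<noteq> 0" "finite I" using fin by simp_all
  have gen: "\<exists>c. (\<forall>i. c i \<in> ring_centre) \<and> \<zeta> * r = (\<Sum>i\<in>I. c i * g i)" for r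
    by (rule fin[THEN conjunct2, THEN conjunct2, THEN conjunct2, THEN spec])
  have sub: "S \<subseteq> carrier ?M" by (rule subringE(1)[OF assms(5)])
  have inverse_mem: "V \<in> S" if "U \<in> S" "V \<in> carrier ?M" "U * V = 1\<^sub>m n" for U V
  proof -
    obtain k c where kc: "(\<forall>l. c l \<in> ring_centre) \<and>
        (\<forall>i<n. \<forall>j<n. (V ^\<^sub>m k) $$ (i, j) = (\<Sum>l<k. c l * (V ^\<^sub>m l) $$ (i, j)))"
      using inverse_mat_power_relation[OF assms(1,3) \<zeta> gen, of n V] by (elim exE)
    show ?thesis
    proof (rule inverse_mem_subring[OF assms(5,6) that(1)])
      show "V \<in> carrier_mat n n" "U * V = 1\<^sub>m n" using that by (simp_all add: ring_mat_simps)
      show "c l \<in> ring_centre" for l using kc by simp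
      show "(V ^\<^sub>m k) $$ (i, j) = (\<Sum>l<k. c l * (V ^\<^sub>m l) $$ (i, j))" if "i < n" "j < n" for i j
        by (rule kc[THEN conjunct2, THEN spec, THEN mp, THEN spec, THEN mp, OF that])
    qed
  qed
  show ?thesis
  proof (intro equalityI subsetI)
    fix U assume "U \<in> S \<inter> Units ?M"
    then obtain V where V: "U \<in> S" "V \<in> carrier ?M" "V * U = 1\<^sub>m n" "U * V = 1\<^sub>m n"
      by (auto simp: Units_def ring_mat_simps)
    have "V \<in> S" by (rule inverse_mem[OF V(1,2,4)])
    then show "U \<in> Units (?M\<lparr>carrier := S\<rparr>)"
      using V by (auto simp: Units_def ring_mat_simps)
  next
    fix U assume "U \<in> Units (?M\<lparr>carrier := S\<rparr>)"
    then show "U \<in> S \<inter> Units ?M"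
      using sub by (auto simp: Units_def ring_mat_simps)
  qed
qed

end
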